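(* Fix $K\ge 2$ and consider the $K$-armed Gaussian bandit setting described in the context. (a) (Pre-specified constraints.) Let $p\in[0,1]^K$ with $\sum_a p_a\le 1$. Then any $p$-fair $\delta$-PAC algorithm satisfies, for every $\theta\in\Theta$ and every $\delta\in(0,1/2)$, $$\frac{\mathbb{E}_\theta[\tau_\delta]}{\log(1/(2.4\delta))}\ \ge\ T^\star_p(\theta).$$ (b) ($\theta$-dependent constraints.) Let $p:\mathbb{R}^K\to[0,1]^K$ be continuous with $\sum_a p_a(\theta')\le 1$ for all $\theta'$. Then any asymptotically $p(\theta)$-fair $\delta$-PAC algorithm satisfies, for every $\theta\in\Theta$, $$\liminf_{\delta\to 0}\frac{\mathbb{E}_\theta[\tau_\delta]}{\log(1/\delta)}\ \ge\ T^\star_{p(\theta)}(\theta).$$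
   Context: Bandit model: arms $[K]=\{1,\dots,K\}$; an unknown parameter $\theta\in\Theta:=\{\theta\in\mathbb{R}^K:\ \arg\max_a\theta_a \text{ is a singleton}\}$. In each round $t\ge1$ the learner chooses an arm $a_t\in[K]$ and observes $r_t\sim\mathcal{N}(\theta_{a_t},1)$, independently of the past given $a_t$. Let $a^\star=\arg\max_a\theta_a$, $\Delta_a=\theta_{a^\star}-\theta_a$, $N_a(t)=\sum_{s\le t}\mathbf 1\{a_s=a\}$, and $\mathcal F_t=\sigma(a_1,r_1,\dots,a_t,r_t)$. An algorithm (for confidence $\delta$) consists of a sampling rule ($a_t$ is $\mathcal F_{t-1}$-measurable, possibly using independent internal randomization), a stopping time $\tau_\delta$ w.r.t. $(\mathcal F_t)$, and a decision $\hat a_{\tau_\delta}$ that is $\mathcal F_{\tau_\delta}$-measurable. For $p\in[0,1]^K$ with $\sum_ap_a\le1$ let $\Sigma_p=\{w\in[0,1]^K:\ w_a\ge p_a\ \forall a,\ \sum_a w_a=1\}$ and define the characteristic time $$T^\star_p(\theta)=2\inf_{w\in\Sigma_p}\max_{a\ne a^\star}\frac{w_a^{-1}+w_{a^\star}^{-1}}{\Delta_a^2}.$$ An algorithm is $p$-fair $\delta$-PAC (for pre-specified $p\in[0,1]^K$) if for all $\theta\in\Theta$ and $\delta\in(0,1/2)$: (i) $\mathbb{E}_\theta[N_a(\tau_\delta)]/\mathbb{E}_\theta[\tau_\delta]\ge p_a$ for all $a$; (ii) $\mathbb{P}_\theta(\hat a_{\tau_\delta}\ne a^\star)\le\delta$;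 (iii) $\mathbb{P}_\theta(\tau_\delta<\infty)=1$. For a continuous $p:\mathbb{R}^K\to[0,1]^K$, an algorithm (family indexed by $\delta$) is asymptotically $p(\theta)$-fair $\delta$-PAC if for all $\theta\in\Theta$ and $\delta\in(0,1/2)$, (ii) and (iii) hold, and (i') $\liminf_{\delta\to0}\mathbb{E}_\theta[N_a(\tau_\delta)]/\mathbb{E}_\theta[\tau_\delta]\ge p_a(\theta)$ for all $a$.
   Formalization: In (a) the bound is proved as E[τ] ≥ T*·log(1/(2.4δ)); the quotient form is false or undefined for δ in [5/12, 1/2), where the logarithm is ≤ 0. Fairness ratios are likewise written with cleared denominators. *)

theory Defs
  imports "HOL-Probability.Probability"
begin

text \<open>
  K-armed Gaussian bandit. Arms are the elements of a finite type 'k (so K = CARD('k)),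
  parameters are vectors theta :: real^'k::finite.

  Probability space (stack-of-rewards model): for each arm a and each n, an
  independent reward X(a,n) ~ N(theta_a, 1) (the reward obtained at the (n+1)-th pull
  of arm a), together with an independent sequence of uniform [0,1] seeds, which
  is the internal randomization of the algorithm.
\<close>

type_synonym 'k hist = "('k \<times> real) list"
type_synonym 'k omega = "(('k \<times> nat) \<Rightarrow> real) \<times> (nat \<Rightarrow> real)"

definition reward_space :: "real^'k::finite \<Rightarrow> (('k \<times> nat) \<Rightarrow> real) measure" where
  "reward_space \<theta> = (\<Pi>\<^sub>M an\<in>UNIV. density lborel (normal_density (\<theta> $ fst an) 1))"

definition seed_space :: "(nat \<Rightarrow> real) measure" where
  "seed_space = (\<Pi>\<^sub>M n\<in>UNIV. uniform_measure lborel {0..1::real})"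

definition bandit_space :: "real^'k::finite \<Rightarrow> 'k omega measure" where
  "bandit_space \<theta> = reward_space \<theta> \<Otimes>\<^sub>M seed_space"

fun hist :: "('k::finite hist \<Rightarrow> (nat \<Rightarrow> real) \<Rightarrow> 'k) \<Rightarrow> 'k omega \<Rightarrow> nat \<Rightarrow> 'k hist" where
  "hist \<pi> \<omega> 0 = []"
| "hist \<pi> \<omega> (Suc t) =
     (let h = hist \<pi> \<omega> t; a = \<pi> h (snd \<omega>); n = length (filter (\<lambda>x. fst x = a) h)
      in h @ [(a, fst \<omega> (a, n))])"

text \<open>Arm a_{t+1} played in round t+1.\<close>
definition arm_at :: "('k::finite hist \<Rightarrow> (nat \<Rightarrow> real) \<Rightarrow> 'k) \<Rightarrow> 'k omega \<Rightarrow> nat \<Rightarrow> 'k" where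
  "arm_at \<pi> \<omega> t = \<pi> (hist \<pi> \<omega> t) (snd \<omega>)"

definition stop_time :: "('k::finite hist \<Rightarrow> (nat \<Rightarrow> real) \<Rightarrow> 'k) \<Rightarrow> ('k hist \<Rightarrow> bool) \<Rightarrow> 'k omega \<Rightarrow> enat" where
  "stop_time \<pi> stop \<omega> =
     (if \<exists>t. stop (hist \<pi> \<omega> t) then enat (LEAST t. stop (hist \<pi> \<omega> t)) else \<infinity>)"

definition pulls_at_stop :: "('k::finite hist \<Rightarrow> (nat \<Rightarrow> real) \<Rightarrow> 'k) \<Rightarrow> ('k hist \<Rightarrow> bool) \<Rightarrow> 'k \<Rightarrow> 'k omega \<Rightarrow> ennreal" where
  "pulls_at_stop \<pi> stop a \<omega> =
     (\<Sum>t. if enat t < stop_time \<pi> stop \<omega> \<and> arm_at \<pi> \<omega> t = a then 1 else 0)"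

definition exp_tau :: "real^'k::finite \<Rightarrow> ('k hist \<Rightarrow> (nat \<Rightarrow> real) \<Rightarrow> 'k) \<Rightarrow> ('k hist \<Rightarrow> bool) \<Rightarrow> ennreal" where
  "exp_tau \<theta> \<pi> stop = (\<integral>\<^sup>+ \<omega>. ennreal_of_enat (stop_time \<pi> stop \<omega>) \<partial>bandit_space \<theta>)"

definition exp_pulls :: "real^'k::finite \<Rightarrow> ('k hist \<Rightarrow> (nat \<Rightarrow> real) \<Rightarrow> 'k) \<Rightarrow> ('k hist \<Rightarrow> bool) \<Rightarrow> 'k \<Rightarrow> ennreal" where
  "exp_pulls \<theta> \<pi> stop a = (\<integral>\<^sup>+ \<omega>. pulls_at_stop \<pi> stop a \<omega> \<partial>bandit_space \<theta>)"

definition Theta :: "(real^'k::finite) set" where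
  "Theta = {\<theta>. \<exists>!a. \<forall>b. \<theta> $ b \<le> \<theta> $ a}"

definition best_arm :: "real^'k::finite \<Rightarrow> 'k" where
  "best_arm \<theta> = (THE a. \<forall>b. \<theta> $ b \<le> \<theta> $ a)"

definition gap :: "real^'k::finite \<Rightarrow> 'k \<Rightarrow> real" where
  "gap \<theta> a = \<theta> $ best_arm \<theta> - \<theta> $ a"

definition prob_stop :: "real^'k::finite \<Rightarrow> ('k hist \<Rightarrow> (nat \<Rightarrow> real) \<Rightarrow> 'k) \<Rightarrow> ('k hist \<Rightarrow> bool) \<Rightarrow> real" where
  "prob_stop \<theta> \<pi> stop =
     measure (bandit_space \<theta>) {\<omega> \<in> space (bandit_space \<theta>). stop_time \<pi> stop \<omega> < \<infinity>}"

definition prob_error :: "real^'k::finite \<Rightarrow> ('k hist \<Rightarrow> (nat \<Rightarrow> real) \<Rightarrow> 'k) \<Rightarrow> ('k hist \<Rightarrow> bool)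
    \<Rightarrow> ('k hist \<Rightarrow> 'k) \<Rightarrow> real" where
  "prob_error \<theta> \<pi> stop dec =
     measure (bandit_space \<theta>) {\<omega> \<in> space (bandit_space \<theta>).
        stop_time \<pi> stop \<omega> < \<infinity> \<and>
        dec (hist \<pi> \<omega> (the_enat (stop_time \<pi> stop \<omega>))) \<noteq> best_arm \<theta>}"

text \<open>Well-formedness of an algorithm (pi, stop, dec): the sampling rule, stopping rule
  and decision rule are functions of the observed history (plus the internal seeds
  for the sampling rule) by construction; additionally the induced random
  variables must be measurable.\<close>
definition measurable_alg :: "('k::finite hist \<Rightarrow> (nat \<Rightarrow> real) \<Rightarrow> 'k) \<Rightarrow> ('k hist \<Rightarrow> bool) \<Rightarrow> ('k hist \<Rightarrow> 'k) \<Rightarrow> bool" where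
  "measurable_alg \<pi> stop dec \<longleftrightarrow> (\<forall>\<theta> t.
     (\<lambda>\<omega>. arm_at \<pi> \<omega> t) \<in> measurable (bandit_space \<theta>) (count_space UNIV) \<and>
     (\<lambda>\<omega>. stop (hist \<pi> \<omega> t)) \<in> measurable (bandit_space \<theta>) (count_space UNIV) \<and>
     (\<lambda>\<omega>. dec (hist \<pi> \<omega> t)) \<in> measurable (bandit_space \<theta>) (count_space UNIV))"

definition pac_at :: "real \<Rightarrow> real^'k::finite \<Rightarrow> ('k hist \<Rightarrow> (nat \<Rightarrow> real) \<Rightarrow> 'k) \<Rightarrow> ('k hist \<Rightarrow> bool) \<Rightarrow> ('k hist \<Rightarrow> 'k) \<Rightarrow> bool" where
  "pac_at \<delta> \<theta> \<pi> stop dec \<longleftrightarrow> prob_error \<theta> \<pi> stop dec \<le> \<delta> \<and> prob_stop \<theta> \<pi> stop = 1"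

text \<open>p-fair delta-PAC family of algorithms (indexed by delta). Condition (i)
  E[N_a(tau)]/E[tau] >= p_a is written with cleared denominator.\<close>
definition fair_PAC :: "real^'k::finite \<Rightarrow> (real \<Rightarrow> 'k hist \<Rightarrow> (nat \<Rightarrow> real) \<Rightarrow> 'k) \<Rightarrow> (real \<Rightarrow> 'k hist \<Rightarrow> bool)
    \<Rightarrow> (real \<Rightarrow> 'k hist \<Rightarrow> 'k) \<Rightarrow> bool" where
  "fair_PAC p \<pi> stop dec \<longleftrightarrow>
     (\<forall>\<delta>. measurable_alg (\<pi> \<delta>) (stop \<delta>) (dec \<delta>)) \<and>
     (\<forall>\<theta>\<in>Theta. \<forall>\<delta>\<in>{0<..<1/2}.
        (\<forall>a. ennreal (p $ a) * exp_tau \<theta> (\<pi> \<delta>) (stop \<delta>) \<le> exp_pulls \<theta> (\<pi> \<delta>) (stop \<delta>) a) \<and>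
        pac_at \<delta> \<theta> (\<pi> \<delta>) (stop \<delta>) (dec \<delta>))"

text \<open>Asymptotically p(theta)-fair delta-PAC family. Condition (i'),
  liminf_{delta->0} E[N_a(tau)]/E[tau] >= p_a(theta), written with cleared denominators:
  for every eps > 0, eventually as delta -> 0+, E[N_a] >= (p_a(theta) - eps) E[tau].\<close>
definition asym_fair_PAC :: "(real^'k::finite \<Rightarrow> real^'k) \<Rightarrow> (real \<Rightarrow> 'k hist \<Rightarrow> (nat \<Rightarrow> real) \<Rightarrow> 'k)
    \<Rightarrow> (real \<Rightarrow> 'k hist \<Rightarrow> bool) \<Rightarrow> (real \<Rightarrow> 'k hist \<Rightarrow> 'k) \<Rightarrow> bool" where
  "asym_fair_PAC p \<pi> stop dec \<longleftrightarrow>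
     (\<forall>\<delta>. measurable_alg (\<pi> \<delta>) (stop \<delta>) (dec \<delta>)) \<and>
     (\<forall>\<theta>\<in>Theta.
        (\<forall>\<delta>\<in>{0<..<1/2}. pac_at \<delta> \<theta> (\<pi> \<delta>) (stop \<delta>) (dec \<delta>)) \<and>
        (\<forall>a. \<forall>\<epsilon>>0. \<forall>\<^sub>F \<delta> in at_right 0.
           ennreal (p \<theta> $ a - \<epsilon>) * exp_tau \<theta> (\<pi> \<delta>) (stop \<delta>) \<le> exp_pulls \<theta> (\<pi> \<delta>) (stop \<delta>) a))"

definition einv :: "real \<Rightarrow> ereal" where
  "einv w = (if w = 0 then \<infinity> else ereal (1 / w))"

definition Sigma_p :: "real^'k::finite \<Rightarrow> (real^'k) set" where
  "Sigma_p p = {w. (\<forall>a. 0 \<le> w $ a \<and> w $ a \<le> 1 \<and> p $ a \<le> w $ a) \<and> (\<Sum>a\<in>UNIV. w $ a) = 1}"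

definition T_star :: "real^'k::finite \<Rightarrow> real^'k \<Rightarrow> ereal" where
  "T_star p \<theta> = 2 * (INF w\<in>Sigma_p p. SUP a\<in>{a. a \<noteq> best_arm \<theta>}.
       (einv (w $ a) + einv (w $ best_arm \<theta>)) / ereal ((gap \<theta> a)\<^sup>2))"

end

(*
  Let d be the confidence level. For a second parameter eta whose best arm differs from
  that of theta, the event "the decision differs from the best arm of theta" has probability at most
  d under theta and at least 1 - d under eta. The likelihood ratio of the two laws on the stopped
  history is exp (- W), where W is a sum of Gaussian log-likelihood ratios along the run, and Wald's
  identity gives E_theta[W] = sum_a E_theta[N_a] (theta_a - eta_a)^2 / 2. Bounding -W pointwise with
  ln u <= u - 1 and integrating yields
    sum_a E_theta[N_a] (theta_a - eta_a)^2 / 2 >= kl (d, 1 - d) >= ln (1 / (2.4 d)).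
  Letting eta give the best arm and one other arm a common mean mu, and optimising over mu, this
  becomes the bound with the characteristic time, since the frequencies w_a = E[N_a] / E[tau] belong
  to Sigma_p. In the asymptotic case the frequencies are only approximately in Sigma_p; they lie in
  a compact set, and the bounds for fixed mu, being linear in w, survive the passage to a limit.
*)
theory Submission
  imports Defs
begin

subsection \<open>The binary relative entropy and the characteristic time\<close>

text \<open>Both the likelihood ratio and Wald's identity rest on a reward being independent of the
  past given the arm. The rules of an algorithm are arbitrary functions of the history (and, for
  sampling, of the seeds), and measurability is required only of the random variables they induce,
  which offers no convenient filtration to condition on. The stack of rewards takes the place of
  conditioning: the cell about to be read has influenced nothing so far, so overwriting it with a
  fresh draw changes neither the past nor the law of the outcome. A statement about a reward given
  the past thus becomes an identity between integrals of nonnegative functions. Signs enter only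
  afterwards, when a finite \<open>exp_tau\<close> allows positive and negative parts to be
  subtracted.\<close>

text \<open>The function \<open>(1 - 2 * \<delta>) * ln ((1 - \<delta>) / \<delta>) + ln (2.4 * \<delta>)\<close> is convex, with minimum close to
  \<open>\<delta> = 10 / 31\<close> and minimal value about \<open>0.0075\<close>; the proof bounds it from below by its tangent at
  that point.\<close>
lemma binary_kl_ge_ln:
  fixes \<delta> :: real
  assumes \<delta>: "0 < \<delta>" "\<delta> < 1/2"
  shows "ln (1 / (2.4 * \<delta>)) \<le> (1 - 2 * \<delta>) * ln ((1 - \<delta>) / \<delta>)"
proof -
  \<comment> \<open>\<open>252/155\<close> and \<open>24/31\<close> are
    \<open>2.4 * (1 - \<delta>)\<close> and \<open>2.4 * \<delta>\<close> at
    \<open>\<delta> = 10/31\<close>. The rational lower bounds \<open>10/21\<close> and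
    \<open>- (11/42)\<close> for their logarithms are chosen so that the slack of the final
    inequality, multiplied by \<open>1 - \<delta>\<close>, is a square vanishing at that
    point.\<close>
  have "exp (- (10/21)) \<ge> (1 - (10/21) / real 16) ^ 16"
    by (rule exp_ge_one_minus_x_over_n_power_n) auto
  moreover have "(1 - (10/21) / real 16) ^ 16 \<ge> (155/252 :: real)" by (simp add: power_divide)
  ultimately have "exp (- (10/21)) \<ge> (155/252 :: real)" by linarith
  then have "exp (10/21) \<le> (252/155 :: real)" by (simp add: exp_minus field_simps)
  then have A: "10/21 \<le> ln (252/155 :: real)" by (intro ln_ge_iff[THEN iffD2]) simp_all
  have "1 + 11/42 + (11/42)\<^sup>2 / 2 \<le> exp (11/42 :: real)"
    by (rule exp_lower_Taylor_quadratic) simp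
  then have "31/24 \<le> exp (11/42 :: real)" by (simp add: power2_eq_square)
  then have "ln (31/24) \<le> ln (exp (11/42 :: real))" by (subst ln_le_cancel_iff) simp_all
  then have "ln (31/24) \<le> (11/42 :: real)" by simp
  then have B: "- (11/42) \<le> ln (24/31 :: real)" by (simp add: ln_div)
  have gibbs: "1 - y / x \<le> ln (x / y)" if "x > 0" "y > 0" for x y :: real
    using ln_le_minus_one[of "y / x"] ln_divide_pos[OF that] ln_divide_pos[OF that(2,1)] that by simp
  have C: "1 - (21/31) / (1 - \<delta>) \<le> ln ((1 - \<delta>) / (21/31))"
    and D: "1 - (10/31) / \<delta> \<le> ln (\<delta> / (10/31))"
    using \<delta> by (intro gibbs; simp)+
  have "ln (252/155) = ln (21/31) + ln (2.4 :: real)" "ln (24/31) = ln (10/31) + ln (2.4 :: real)"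
    by (subst ln_mult_pos[symmetric]; simp)+
  then have E: "ln ((1 - \<delta>) / (21/31)) + ln (252/155) = ln (1 - \<delta>) + ln 2.4"
    and F: "ln (\<delta> / (10/31)) + ln (24/31) = ln \<delta> + ln 2.4"
    using \<delta> ln_divide_pos[of "1 - \<delta>" "21/31"] ln_divide_pos[of \<delta> "10/31"] by linarith+
  have "(1 - 2 * \<delta>) * (21/31) / (1 - \<delta>) \<le> (1 - 2 * \<delta>) * (31/21) + 2 * \<delta> * (31/42) - 20/31"
  proof (subst pos_divide_le_eq)
    have "((1 - 2 * \<delta>) * (31/21) + 2 * \<delta> * (31/42) - 20/31) * (1 - \<delta>) - (1 - 2 * \<delta>) * (21/31)
        = (31/21) * (\<delta> - 10/31)\<^sup>2"
      by (simp add: power2_eq_square field_simps)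
    moreover have "0 \<le> (31/21) * (\<delta> - 10/31)\<^sup>2" by simp
    ultimately show "(1 - 2 * \<delta>) * (21/31) \<le>
        ((1 - 2 * \<delta>) * (31/21) + 2 * \<delta> * (31/42) - 20/31) * (1 - \<delta>)" by linarith
  qed (use \<delta> in simp)
  moreover have "(1 - 2 * \<delta>) * ((1 - x) + 10/21) + 2 * \<delta> * ((1 - y) + - (11/42)) =
      (1 - 2 * \<delta>) * (31/21) + 2 * \<delta> * (31/42) - (1 - 2 * \<delta>) * x - 2 * \<delta> * y" for x y
    by (simp add: field_simps)
  moreover have "2 * \<delta> * ((10/31) / \<delta>) = 20/31" using \<delta> by simp
  ultimately have "0 \<le> (1 - 2 * \<delta>) * ((1 - (21/31) / (1 - \<delta>)) + 10/21)
      + 2 * \<delta> * ((1 - (10/31) / \<delta>) + - (11/42))"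
    by (simp only: times_divide_eq_right)
  also have "\<dots> \<le> (1 - 2 * \<delta>) * (ln ((1 - \<delta>) / (21/31)) + ln (252/155))
      + 2 * \<delta> * (ln (\<delta> / (10/31)) + ln (24/31))"
    using \<delta> A B C D by (intro add_mono mult_left_mono) auto
  also have "\<dots> = (1 - 2 * \<delta>) * ln (1 - \<delta>) + 2 * \<delta> * ln \<delta> + ln 2.4"
    unfolding E F by (simp add: algebra_simps)
  finally show ?thesis
    using \<delta> by (simp add: ln_div ln_mult algebra_simps)
qed

section \<open>Best arms, gaps and the characteristic time\<close>

lemma best_arm_unique: "\<theta> \<in> Theta \<Longrightarrow> (\<forall>b. \<theta> $ b \<le> \<theta> $ a) \<longleftrightarrow> a = best_arm \<theta>"
proof -
  assume "\<theta> \<in> Theta"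
  then have ex1: "\<exists>!a. \<forall>b. \<theta> $ b \<le> \<theta> $ a" by (simp add: Theta_def)
  from theI'[OF ex1] have "\<forall>b. \<theta> $ b \<le> \<theta> $ best_arm \<theta>" unfolding best_arm_def .
  then show ?thesis using ex1 by blast
qed

lemma gap_pos:
  assumes "\<theta> \<in> Theta" "a \<noteq> best_arm \<theta>"
  shows "gap \<theta> a > 0"
proof -
  have best: "\<theta> $ b \<le> \<theta> $ best_arm \<theta>" for b
    using best_arm_unique[OF assms(1)] by blast
  obtain b where "\<not> \<theta> $ b \<le> \<theta> $ a"
    using best_arm_unique[OF assms(1), of a] assms(2) by blast
  then show ?thesis using best[of b] by (simp add: gap_def)
qed

lemma ex_suboptimal:
  assumes "CARD('k::finite) \<ge> 2"
  obtains a where "a \<noteq> best_arm (\<theta> :: real^'k)"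
proof -
  have "(UNIV :: 'k set) \<noteq> {best_arm \<theta>}"
  proof
    assume "(UNIV :: 'k set) = {best_arm \<theta>}"
    then have "CARD('k) = card {best_arm \<theta>}" by (rule arg_cong)
    with assms show False by simp
  qed
  then show ?thesis using that by blast
qed

text \<open>Serves the confidence levels with \<open>2.4 * \<delta> \<ge> 1\<close>, where the
  logarithm is not positive and only the sign of the characteristic time matters. A suboptimal arm
  is required, since the supremum over no arms is the bottom element.\<close>

lemma T_star_nonneg:
  assumes "CARD('k::finite) \<ge> 2"
  shows "0 \<le> T_star (p :: real^'k) \<theta>"
proof -
  obtain a where a: "a \<noteq> best_arm \<theta>" by (rule ex_suboptimal[OF assms])
  have "0 \<le> (INF w\<in>Sigma_p p. SUP a\<in>{a. a \<noteq> best_arm \<theta>}.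
       (einv (w $ a) + einv (w $ best_arm \<theta>)) / ereal ((gap \<theta> a)\<^sup>2))"
  proof (rule INF_greatest)
    fix w assume "w \<in> Sigma_p p"
    then have "0 \<le> einv (w $ b)" for b by (auto simp: einv_def Sigma_p_def)
    then have "0 \<le> (einv (w $ a) + einv (w $ best_arm \<theta>)) / ereal ((gap \<theta> a)\<^sup>2)"
      unfolding divide_ereal_def by (intro ereal_0_le_mult add_nonneg_nonneg) (auto simp: zero_ereal_def)
    then show "0 \<le> (SUP a\<in>{a. a \<noteq> best_arm \<theta>}.
       (einv (w $ a) + einv (w $ best_arm \<theta>)) / ereal ((gap \<theta> a)\<^sup>2))"
      using a by (intro SUP_upper2) auto
  qed
  then show ?thesis unfolding T_star_def by (intro ereal_0_le_mult) auto
qed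

text \<open>With weights \<open>u\<close>, \<open>v\<close> and gap \<open>d\<close>, the two-arm
  cost in the hypothesis has minimum \<open>d^2 / (1/u + 1/v) / 2\<close> over the common mean
  \<open>\<mu>\<close>. This is where the sum of inverse weights in the characteristic time comes
  from.\<close>

lemma T_star_mult_le:
  assumes \<theta>: "\<theta> \<in> Theta" and w: "w \<in> Sigma_p p" and L: "0 < L"
    and bound: "\<And>a \<mu>. a \<noteq> best_arm \<theta> \<Longrightarrow>
      L \<le> T * ((w $ best_arm \<theta> * (\<theta> $ best_arm \<theta> - \<mu>)\<^sup>2 + w $ a * (\<theta> $ a - \<mu>)\<^sup>2) / 2)"
    and T: "0 \<le> T"
  shows "T_star p \<theta> * ereal L \<le> ereal T"
proof -
  let ?b = "best_arm \<theta>"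
  have w0: "0 \<le> w $ a" for a using w by (auto simp: Sigma_p_def)
  have each: "(einv (w $ a) + einv (w $ ?b)) / ereal ((gap \<theta> a)\<^sup>2) \<le> ereal (T / (2 * L))"
    if a: "a \<noteq> ?b" for a
  proof -
    define u v d where "u = w $ ?b" and "v = w $ a" and "d = gap \<theta> a"
    have d: "d > 0" using gap_pos[OF \<theta> a] by (simp add: d_def)
    have dd: "\<theta> $ ?b = \<theta> $ a + d" by (simp add: d_def gap_def)
    \<comment> \<open>Putting \<open>\<mu>\<close> at the mean of one of the two arms removes the
      term of that arm, so the weight of the other cannot be zero and \<open>einv\<close> is finite
      at both.\<close>
    have "u \<noteq> 0" using bound[OF a, of "\<theta> $ a"] L by (auto simp: u_def)
    moreover have "v \<noteq> 0" using bound[OF a, of "\<theta> $ ?b"] L by (auto simp: v_def)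
    ultimately have uv: "u > 0" "v > 0"
      using w0[of ?b] w0[of a] by (auto simp: u_def v_def less_le)
    \<comment> \<open>The minimising \<open>\<mu>\<close> is the mean of the two arms weighted by
      \<open>u\<close> and \<open>v\<close>; it lies \<open>u * d / (u + v)\<close> above the worse
      arm.\<close>
    have "L \<le> T * ((u * (d - u * d / (u + v))\<^sup>2 + v * (u * d / (u + v))\<^sup>2) / 2)"
      using bound[OF a, of "\<theta> $ a + u * d / (u + v)"] by (simp add: u_def v_def dd)
    also have "(u * (d - u * d / (u + v))\<^sup>2 + v * (u * d / (u + v))\<^sup>2) = d\<^sup>2 / (1 / v + 1 / u)"
    proof -
      have "d - u * d / (u + v) = v * d / (u + v)" using uv by (simp add: field_simps)
      then have "(u * (d - u * d / (u + v))\<^sup>2 + v * (u * d / (u + v))\<^sup>2) =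
          (u * (v * d)\<^sup>2 + v * (u * d)\<^sup>2) / (u + v)\<^sup>2"
        by (simp only: power_divide) (simp add: add_divide_distrib)
      also have "u * (v * d)\<^sup>2 + v * (u * d)\<^sup>2 = u * v * d\<^sup>2 * (u + v)"
        by (simp add: power2_eq_square algebra_simps)
      also have "\<dots> / (u + v)\<^sup>2 = u * v * d\<^sup>2 / (u + v)" using uv by (simp add: power2_eq_square)
      also have "\<dots> = d\<^sup>2 / (1 / v + 1 / u)" using uv by (simp add: field_simps)
      finally show ?thesis .
    qed
    finally have *: "L \<le> T * (d\<^sup>2 / (1 / v + 1 / u) / 2)" .
    have pos: "0 < 1 / v + 1 / u" "0 < d\<^sup>2" using uv d by (auto intro: add_pos_pos)
    have "(1 / v + 1 / u) / d\<^sup>2 \<le> T / (2 * L)"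
      using * pos L by (simp add: field_simps del: zero_less_power2)
    then show ?thesis using uv d by (simp add: einv_def u_def v_def d_def)
  qed
  have "T_star p \<theta> \<le> 2 * ereal (T / (2 * L))"
    unfolding T_star_def
    by (intro ereal_mult_left_mono INF_lower2[OF w] SUP_least) (use each in auto)
  then have "T_star p \<theta> * ereal L \<le> 2 * ereal (T / (2 * L)) * ereal L"
    using L by (intro ereal_mult_right_mono) auto
  also have "2 * ereal (T / (2 * L)) * ereal L = ereal T"
    using L by (simp add: numeral_eq_ereal)
  finally show ?thesis .
qed

subsection \<open>Resampling a reward that has not been observed\<close>

definition arm_law :: "real^'k::finite \<Rightarrow> 'k \<Rightarrow> real measure" where
  "arm_law \<theta> a = density lborel (normal_density (\<theta> $ a) 1)"

lemma sets_arm_law [measurable_cong, simp]: "sets (arm_law \<theta> a) = sets borel"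
  by (simp add: arm_law_def)

lemma prob_space_arm_law: "prob_space (arm_law \<theta> a)"
  unfolding arm_law_def by (rule prob_space_normal_density) simp

lemma nn_integral_arm_law:
  assumes "f \<in> borel_measurable borel"
  shows "(\<integral>\<^sup>+x. f x \<partial>arm_law \<theta> a) = (\<integral>\<^sup>+x. ennreal (normal_density (\<theta> $ a) 1 x) * f x \<partial>lborel)"
  unfolding arm_law_def using assms by (intro nn_integral_density) auto

lemma reward_space_eq: "reward_space \<theta> = (\<Pi>\<^sub>M i\<in>UNIV. arm_law \<theta> (fst i))"
  by (simp add: reward_space_def arm_law_def)

text \<open>Only the sigma-algebra matters: it is shared by \<open>bandit_space \<theta>\<close> for
  all parameters, so measurability is proved once and used under both \<open>\<theta>\<close> and
  \<open>\<eta>\<close>.\<close>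

definition outcome_borel :: "'k::finite omega measure" where
  "outcome_borel = (\<Pi>\<^sub>M i\<in>UNIV. borel) \<Otimes>\<^sub>M (\<Pi>\<^sub>M n\<in>UNIV. borel)"

lemma sets_reward_space: "sets (reward_space \<theta>) = sets (\<Pi>\<^sub>M i\<in>UNIV. borel)"
  unfolding reward_space_eq by (intro sets_PiM_cong) auto

lemma sets_seed_space: "sets seed_space = sets (\<Pi>\<^sub>M n\<in>UNIV. borel)"
  unfolding seed_space_def by (intro sets_PiM_cong) auto

lemma sets_bandit_space [measurable_cong, simp]: "sets (bandit_space \<theta>) = sets outcome_borel"
  unfolding bandit_space_def outcome_borel_def
  by (intro sets_pair_measure_cong sets_reward_space sets_seed_space)

lemma space_outcome_borel [simp]: "space outcome_borel = UNIV"
  by (simp add: outcome_borel_def space_pair_measure space_PiM)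

lemma space_bandit_space [simp]: "space (bandit_space \<theta>) = UNIV"
  using sets_eq_imp_space_eq[OF sets_bandit_space] by simp

lemma prob_space_reward_space: "prob_space (reward_space \<theta>)"
  unfolding reward_space_eq by (intro prob_space_PiM prob_space_arm_law)

lemma prob_space_seed_space: "prob_space seed_space"
  unfolding seed_space_def by (intro prob_space_PiM prob_space_uniform_measure) auto

lemma prob_space_bandit_space: "prob_space (bandit_space \<theta>)"
proof -
  interpret R: prob_space "reward_space \<theta>" by (rule prob_space_reward_space)
  interpret S: prob_space seed_space by (rule prob_space_seed_space)
  interpret pair_prob_space "reward_space \<theta>" seed_space ..
  show ?thesis unfolding bandit_space_def by unfold_locales
qed

definition upd_cell :: "'k omega \<Rightarrow> 'k \<times> nat \<Rightarrow> real \<Rightarrow> 'k omega" where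
  "upd_cell \<omega> i x = ((fst \<omega>)(i := x), snd \<omega>)"

lemma measurable_upd_cell [measurable]:
  "(\<lambda>z. upd_cell (fst z) i (snd z)) \<in> measurable (outcome_borel \<Otimes>\<^sub>M borel) outcome_borel"
proof -
  have [measurable]: "(\<lambda>z. fst (fst z)) \<in> measurable (outcome_borel \<Otimes>\<^sub>M (borel::real measure)) (\<Pi>\<^sub>M i\<in>UNIV. borel)"
    "(\<lambda>z. snd (fst z)) \<in> measurable (outcome_borel \<Otimes>\<^sub>M (borel::real measure)) (\<Pi>\<^sub>M i\<in>UNIV. borel)"
    unfolding outcome_borel_def by measurable
  have [measurable]: "(\<lambda>z. (fst (fst z))(i := snd z))
      \<in> measurable (outcome_borel \<Otimes>\<^sub>M (borel::real measure)) (\<Pi>\<^sub>M i\<in>UNIV. borel)"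
    by (rule measurable_fun_upd[where J=UNIV]) auto
  have "(\<lambda>z. upd_cell (fst z) i (snd z))
      \<in> measurable (outcome_borel \<Otimes>\<^sub>M borel) ((\<Pi>\<^sub>M i\<in>UNIV. borel) \<Otimes>\<^sub>M (\<Pi>\<^sub>M n\<in>UNIV. borel))"
    unfolding upd_cell_def by measurable
  then show ?thesis by (simp only: outcome_borel_def[symmetric])
qed

text \<open>A product measure is invariant under overwriting one coordinate by an independent draw
  from its marginal. The seeds are held fixed during this and integrated last.\<close>

lemma nn_integral_resample:
  assumes F: "F \<in> borel_measurable outcome_borel"
  shows "(\<integral>\<^sup>+\<omega>. F \<omega> \<partial>bandit_space \<theta>) =
    (\<integral>\<^sup>+\<omega>. (\<integral>\<^sup>+x. F (upd_cell \<omega> i x) \<partial>arm_law \<theta> (fst i)) \<partial>bandit_space \<theta>)"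
proof -
  let ?R = "reward_space \<theta>" and ?S = seed_space and ?N = "arm_law \<theta> (fst i)"
  interpret R: prob_space ?R by (rule prob_space_reward_space)
  interpret S: prob_space ?S by (rule prob_space_seed_space)
  interpret N: prob_space ?N by (rule prob_space_arm_law)
  interpret RS: pair_prob_space ?R ?S ..
  interpret NR: pair_prob_space ?N ?R ..
  have sN: "sets (?R \<Otimes>\<^sub>M ?S) = sets outcome_borel"
    using sets_bandit_space[of \<theta>] by (simp add: bandit_space_def)
  have F' [measurable]: "F \<in> borel_measurable (?R \<Otimes>\<^sub>M ?S)"
    using F by (simp add: measurable_cong_sets[OF sN refl])
  note [measurable] = F
  \<comment> \<open>Adding coordinate \<open>i\<close> to a product indexed by \<open>UNIV\<close>
    leaves the index set as it is, so the new value replaces the old one.\<close>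
  have eqR: "distr (?N \<Otimes>\<^sub>M ?R) ?R (\<lambda>(x, X). X(i := x)) = ?R"
    using distr_pair_PiM_eq_PiM[of UNIV "\<lambda>i. arm_law \<theta> (fst i)" i]
    by (simp add: reward_space_eq prob_space_arm_law)
  have upd: "(\<lambda>z. (snd z)(i := fst z)) \<in> measurable (?N \<Otimes>\<^sub>M ?R) ?R"
    unfolding reward_space_eq by (rule measurable_fun_upd[where J=UNIV]) auto
  have inner: "(\<integral>\<^sup>+r. F (r, s) \<partial>?R) = (\<integral>\<^sup>+r. \<integral>\<^sup>+x. F (upd_cell (r, s) i x) \<partial>?N \<partial>?R)"
    if s: "s \<in> space ?S" for s
  proof -
    have Fs [measurable]: "(\<lambda>r. F (r, s)) \<in> borel_measurable ?R"
      using F' s by (rule measurable_Pair1)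
    have "(\<integral>\<^sup>+r. F (r, s) \<partial>?R) = (\<integral>\<^sup>+z. F ((snd z)(i := fst z), s) \<partial>(?N \<Otimes>\<^sub>M ?R))"
      by (subst (1) eqR[symmetric], subst nn_integral_distr)
         (use upd in \<open>auto simp: case_prod_beta'\<close>)
    also have "\<dots> = (\<integral>\<^sup>+r. \<integral>\<^sup>+x. F (r(i := x), s) \<partial>?N \<partial>?R)"
      by (subst NR.nn_integral_snd[symmetric]) (use measurable_compose[OF upd Fs] in auto)
    finally show ?thesis by (simp add: upd_cell_def)
  qed
  have G [measurable]: "(\<lambda>\<omega>. \<integral>\<^sup>+x. F (upd_cell \<omega> i x) \<partial>?N) \<in> borel_measurable outcome_borel"
    using measurable_compose[OF measurable_upd_cell[of i] F] by measurable
  then have G' [measurable]: "(\<lambda>\<omega>. \<integral>\<^sup>+x. F (upd_cell \<omega> i x) \<partial>?N) \<in> borel_measurable (?R \<Otimes>\<^sub>M ?S)"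
    by (simp add: measurable_cong_sets[OF sN refl])
  have "(\<integral>\<^sup>+\<omega>. F \<omega> \<partial>bandit_space \<theta>) = (\<integral>\<^sup>+s. \<integral>\<^sup>+r. F (r, s) \<partial>?R \<partial>?S)"
    unfolding bandit_space_def by (rule RS.nn_integral_snd[symmetric]) measurable
  also have "\<dots> = (\<integral>\<^sup>+s. \<integral>\<^sup>+r. \<integral>\<^sup>+x. F (upd_cell (r, s) i x) \<partial>?N \<partial>?R \<partial>?S)"
    by (intro nn_integral_cong inner)
  also have "\<dots> = (\<integral>\<^sup>+\<omega>. (\<integral>\<^sup>+x. F (upd_cell \<omega> i x) \<partial>?N) \<partial>bandit_space \<theta>)"
    unfolding bandit_space_def by (rule RS.nn_integral_snd) measurable
  finally show ?thesis .
qed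

section \<open>The cells read along a run\<close>

definition pulls :: "('k::finite hist \<Rightarrow> (nat \<Rightarrow> real) \<Rightarrow> 'k) \<Rightarrow> 'k omega \<Rightarrow> 'k \<Rightarrow> nat \<Rightarrow> nat" where
  "pulls \<pi> \<omega> a t = length (filter (\<lambda>x. fst x = a) (hist \<pi> \<omega> t))"

text \<open>The second component counts the earlier pulls of the arm from zero, so successive pulls
  of an arm read successive cells and no cell is read twice.\<close>

definition next_cell :: "('k::finite hist \<Rightarrow> (nat \<Rightarrow> real) \<Rightarrow> 'k) \<Rightarrow> 'k omega \<Rightarrow> nat \<Rightarrow> 'k \<times> nat" where
  "next_cell \<pi> \<omega> t = (arm_at \<pi> \<omega> t, pulls \<pi> \<omega> (arm_at \<pi> \<omega> t) t)"

definition reward_at :: "('k::finite hist \<Rightarrow> (nat \<Rightarrow> real) \<Rightarrow> 'k) \<Rightarrow> 'k omega \<Rightarrow> nat \<Rightarrow> real" where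
  "reward_at \<pi> \<omega> t = fst \<omega> (next_cell \<pi> \<omega> t)"

lemma hist_Suc: "hist \<pi> \<omega> (Suc t) = hist \<pi> \<omega> t @ [(arm_at \<pi> \<omega> t, reward_at \<pi> \<omega> t)]"
  by (simp add: Let_def arm_at_def reward_at_def next_cell_def pulls_def)

declare hist.simps(2) [simp del]

lemma length_hist [simp]: "length (hist \<pi> \<omega> t) = t"
  by (induction t) (auto simp: hist_Suc)

lemma nth_hist: "s < t \<Longrightarrow> hist \<pi> \<omega> t ! s = (arm_at \<pi> \<omega> s, reward_at \<pi> \<omega> s)"
  by (induction t) (auto simp: hist_Suc nth_append less_Suc_eq)

lemma take_hist: "s \<le> t \<Longrightarrow> take s (hist \<pi> \<omega> t) = hist \<pi> \<omega> s"
  by (induction t) (auto simp: hist_Suc le_Suc_eq)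

lemma pulls_0 [simp]: "pulls \<pi> \<omega> a 0 = 0"
  by (simp add: pulls_def)

lemma pulls_Suc: "pulls \<pi> \<omega> a (Suc t) = pulls \<pi> \<omega> a t + (if arm_at \<pi> \<omega> t = a then 1 else 0)"
  by (simp add: pulls_def hist_Suc)

lemma pulls_le: "pulls \<pi> \<omega> a t \<le> t"
  by (induction t) (auto simp: pulls_Suc)

text \<open>Cell \<open>(a, n)\<close> is read at pull number \<open>n + 1\<close> of arm
  \<open>a\<close>. While \<open>a\<close> has been pulled at most \<open>n\<close> times its
  content has not been seen and cannot have steered the run.\<close>

lemma hist_upd_cell:
  assumes "pulls \<pi> \<omega> (fst i) t \<le> snd i"
  shows "hist \<pi> (upd_cell \<omega> i x) t = hist \<pi> \<omega> t"
  using assms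
proof (induction t)
  case (Suc t)
  then have h: "hist \<pi> (upd_cell \<omega> i x) t = hist \<pi> \<omega> t"
    by (simp add: pulls_Suc split: if_splits)
  then have a: "arm_at \<pi> (upd_cell \<omega> i x) t = arm_at \<pi> \<omega> t"
    by (simp add: arm_at_def upd_cell_def)
  have n: "next_cell \<pi> (upd_cell \<omega> i x) t = next_cell \<pi> \<omega> t"
    by (simp add: next_cell_def a pulls_def h)
  have "next_cell \<pi> \<omega> t \<noteq> i"
    using Suc.prems by (auto simp: next_cell_def pulls_Suc)
  then show ?case
    by (simp add: hist_Suc h a reward_at_def n) (simp add: upd_cell_def)
qed simp

text \<open>Functions of the first \<open>t\<close> observations and the seeds. As the rules of an algorithm are
  only measurable as functions of the outcome, this replaces measurability with respect to the
  generated sub-sigma-algebra.\<close>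
definition determined_at :: "('k::finite hist \<Rightarrow> (nat \<Rightarrow> real) \<Rightarrow> 'k) \<Rightarrow> nat \<Rightarrow> ('k omega \<Rightarrow> 'b) \<Rightarrow> bool" where
  "determined_at \<pi> t F \<longleftrightarrow> (\<forall>\<omega> \<omega>'. hist \<pi> \<omega> t = hist \<pi> \<omega>' t \<longrightarrow> snd \<omega> = snd \<omega>' \<longrightarrow> F \<omega> = F \<omega>')"

lemma determined_atI:
  "(\<And>\<omega> \<omega>'. hist \<pi> \<omega> t = hist \<pi> \<omega>' t \<Longrightarrow> snd \<omega> = snd \<omega>' \<Longrightarrow> F \<omega> = F \<omega>') \<Longrightarrow> determined_at \<pi> t F"
  unfolding determined_at_def by blast

lemma determined_atD:
  "determined_at \<pi> t F \<Longrightarrow> hist \<pi> \<omega> t = hist \<pi> \<omega>' t \<Longrightarrow> snd \<omega> = snd \<omega>' \<Longrightarrow> F \<omega> = F \<omega>'"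
  unfolding determined_at_def by blast

lemma determined_at_mono:
  assumes "determined_at \<pi> s F" "s \<le> t"
  shows "determined_at \<pi> t F"
proof (rule determined_atI)
  fix \<omega> \<omega>' assume h: "hist \<pi> \<omega> t = hist \<pi> \<omega>' t" "snd \<omega> = snd \<omega>'"
  have "hist \<pi> \<omega> s = hist \<pi> \<omega>' s"
    using arg_cong[OF h(1), of "take s"] by (simp add: take_hist assms(2))
  then show "F \<omega> = F \<omega>'" using assms(1) h by (auto dest: determined_atD)
qed

lemma determined_at_hist: "determined_at \<pi> t (\<lambda>\<omega>. hist \<pi> \<omega> t)"
  by (simp add: determined_at_def)

lemma determined_at_arm_at: "determined_at \<pi> t (\<lambda>\<omega>. arm_at \<pi> \<omega> t)"
  by (simp add: determined_at_def arm_at_def)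

lemma determined_at_next_cell: "determined_at \<pi> t (\<lambda>\<omega>. next_cell \<pi> \<omega> t)"
  by (simp add: determined_at_def next_cell_def pulls_def arm_at_def)

lemma determined_at_comp2:
  "determined_at \<pi> t F \<Longrightarrow> determined_at \<pi> t G \<Longrightarrow> determined_at \<pi> t (\<lambda>\<omega>. g (F \<omega>) (G \<omega>))"
  by (rule determined_atI, rule arg_cong2[where f=g]) (erule determined_atD; assumption)+

lemma hist_upd_next_cell:
  "next_cell \<pi> \<omega> t = i \<Longrightarrow> hist \<pi> (upd_cell \<omega> i x) t = hist \<pi> \<omega> t"
  by (rule hist_upd_cell) (auto simp: next_cell_def)

lemma determined_at_upd_next_cell:
  assumes "determined_at \<pi> t F" "next_cell \<pi> \<omega> t = i"
  shows "F (upd_cell \<omega> i x) = F \<omega>"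
  using assms(1) hist_upd_next_cell[OF assms(2)] by (rule determined_atD) (simp add: upd_cell_def)

lemma upd_cell_upd_cell [simp]: "upd_cell (upd_cell \<omega> i x) i y = upd_cell \<omega> i y"
  by (simp add: upd_cell_def)

lemma upd_cell_triv [simp]: "upd_cell \<omega> i (fst \<omega> i) = \<omega>"
  by (simp add: upd_cell_def)

text \<open>The event on which a cell is resampled must itself be untouched by the resampling. One
  direction follows from the other by writing the old content back into the cell.\<close>

lemma next_cell_upd_cell_iff: "next_cell \<pi> (upd_cell \<omega> i x) t = i \<longleftrightarrow> next_cell \<pi> \<omega> t = i"
proof
  assume "next_cell \<pi> (upd_cell \<omega> i x) t = i"
  from determined_at_upd_next_cell[OF determined_at_next_cell this, of "fst \<omega> i"] this
  show "next_cell \<pi> \<omega> t = i" by simp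
next
  assume "next_cell \<pi> \<omega> t = i"
  from determined_at_upd_next_cell[OF determined_at_next_cell this, of x] this
  show "next_cell \<pi> (upd_cell \<omega> i x) t = i" by simp
qed

lemma hist_Suc_upd_next_cell:
  "hist \<pi> (upd_cell \<omega> (next_cell \<pi> \<omega> t) x) (Suc t) = hist \<pi> \<omega> t @ [(arm_at \<pi> \<omega> t, x)]"
proof -
  let ?i = "next_cell \<pi> \<omega> t"
  have "arm_at \<pi> (upd_cell \<omega> ?i x) t = arm_at \<pi> \<omega> t"
    by (rule determined_at_upd_next_cell[OF determined_at_arm_at]) simp
  moreover have "next_cell \<pi> (upd_cell \<omega> ?i x) t = ?i"
    by (simp add: next_cell_upd_cell_iff)
  ultimately show ?thesis
    by (simp add: hist_Suc hist_upd_next_cell reward_at_def) (simp add: upd_cell_def)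
qed

section \<open>Measurability along a run and the law of the next reward\<close>

locale bandit_alg =
  fixes \<pi> :: "'k::finite hist \<Rightarrow> (nat \<Rightarrow> real) \<Rightarrow> 'k"
    and stop :: "'k hist \<Rightarrow> bool" and dec :: "'k hist \<Rightarrow> 'k"
  assumes measurable_alg: "measurable_alg \<pi> stop dec"
begin

lemma measurable_arm_at [measurable]: "(\<lambda>\<omega>. arm_at \<pi> \<omega> t) \<in> measurable outcome_borel (count_space UNIV)"
  and measurable_stop [measurable]: "Measurable.pred outcome_borel (\<lambda>\<omega>. stop (hist \<pi> \<omega> t))"
  and measurable_dec [measurable]: "(\<lambda>\<omega>. dec (hist \<pi> \<omega> t)) \<in> measurable outcome_borel (count_space UNIV)"
  using measurable_alg unfolding measurable_alg_def
  by (simp_all add: measurable_cong_sets[OF sets_bandit_space refl])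

lemma measurable_pulls [measurable]: "(\<lambda>\<omega>. pulls \<pi> \<omega> a t) \<in> measurable outcome_borel (count_space UNIV)"
  by (induction t) (simp_all add: pulls_Suc)

lemma measurable_next_cell [measurable]:
  "(\<lambda>\<omega>. next_cell \<pi> \<omega> t) \<in> measurable outcome_borel (count_space UNIV)"
proof -
  have "(\<lambda>\<omega>. pulls \<pi> \<omega> (arm_at \<pi> \<omega> t) t) \<in> measurable outcome_borel (count_space UNIV)"
    by (rule measurable_compose_countable[OF measurable_pulls measurable_arm_at])
  then show ?thesis unfolding next_cell_def by measurable
qed

lemma measurable_cell [measurable]: "(\<lambda>\<omega>. fst \<omega> i) \<in> borel_measurable outcome_borel"
  unfolding outcome_borel_def by measurable

lemma measurable_reward_at [measurable]: "(\<lambda>\<omega>. reward_at \<pi> \<omega> t) \<in> borel_measurable outcome_borel"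
  unfolding reward_at_def
  by (rule measurable_compose_countable[OF measurable_cell measurable_next_cell])

lemma measurable_upd_next_cell [measurable]:
  "(\<lambda>z. upd_cell (fst z) (next_cell \<pi> (fst z) t) (snd z))
     \<in> measurable (outcome_borel \<Otimes>\<^sub>M borel) outcome_borel"
  by (rule measurable_compose_countable[OF measurable_upd_cell]) measurable

text \<open>On the event that cell \<open>i\<close> is the next one to be read, nothing seen so far depends on
  the content of \<open>i\<close>, so that cell may be resampled.\<close>
lemma nn_integral_reward_at:
  assumes F [measurable]: "(\<lambda>z. F (fst z) (snd z)) \<in> borel_measurable (outcome_borel \<Otimes>\<^sub>M borel)"
    and det: "determined_at \<pi> t F"
  shows "(\<integral>\<^sup>+\<omega>. F \<omega> (reward_at \<pi> \<omega> t) \<partial>bandit_space \<theta>) =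
    (\<integral>\<^sup>+\<omega>. (\<integral>\<^sup>+y. F \<omega> y \<partial>arm_law \<theta> (arm_at \<pi> \<omega> t)) \<partial>bandit_space \<theta>)"
proof -
  \<comment> \<open>The next cell is random, whereas resampling needs a fixed one. At most
    \<open>t\<close> pulls precede, so the next cell has finitely many possible values and the
    integral splits into a finite sum over them.\<close>
  define A where "A = (UNIV :: 'k set) \<times> {..t}"
  have fin: "finite A" by (simp add: A_def)
  have inA: "next_cell \<pi> \<omega> t \<in> A" for \<omega>
    by (auto simp: A_def next_cell_def pulls_le)
  have split: "G (next_cell \<pi> \<omega> t) = (\<Sum>i\<in>A. if next_cell \<pi> \<omega> t = i then G i else 0)"
    for G :: "'k \<times> nat \<Rightarrow> ennreal" and \<omega>
    using fin inA[of \<omega>] by (simp add: sum.delta')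
  have mF [measurable]: "(\<lambda>\<omega>. F \<omega> (fst \<omega> i)) \<in> borel_measurable outcome_borel" for i
    using measurable_compose[OF _ F, of "\<lambda>\<omega>. (\<omega>, fst \<omega> i)" outcome_borel] by simp
  have mI [measurable]: "(\<lambda>\<omega>. \<integral>\<^sup>+y. F \<omega> y \<partial>arm_law \<theta> a) \<in> borel_measurable outcome_borel" for a
  proof -
    interpret N: prob_space "arm_law \<theta> a" by (rule prob_space_arm_law)
    show ?thesis by (rule N.borel_measurable_nn_integral) (simp only: case_prod_beta', measurable)
  qed
  have "(\<integral>\<^sup>+\<omega>. F \<omega> (reward_at \<pi> \<omega> t) \<partial>bandit_space \<theta>) =
    (\<integral>\<^sup>+\<omega>. (\<Sum>i\<in>A. if next_cell \<pi> \<omega> t = i then F \<omega> (fst \<omega> i) else 0) \<partial>bandit_space \<theta>)"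
    unfolding reward_at_def by (intro nn_integral_cong) (rule split)
  also have "\<dots> = (\<Sum>i\<in>A. \<integral>\<^sup>+\<omega>. (if next_cell \<pi> \<omega> t = i then F \<omega> (fst \<omega> i) else 0) \<partial>bandit_space \<theta>)"
    by (rule nn_integral_sum) measurable
  also have "\<dots> = (\<Sum>i\<in>A. \<integral>\<^sup>+\<omega>. (if next_cell \<pi> \<omega> t = i then \<integral>\<^sup>+y. F \<omega> y \<partial>arm_law \<theta> (fst i) else 0) \<partial>bandit_space \<theta>)"
  proof (rule sum.cong[OF refl])
    fix i
    have "(\<integral>\<^sup>+\<omega>. (if next_cell \<pi> \<omega> t = i then F \<omega> (fst \<omega> i) else 0) \<partial>bandit_space \<theta>) =
      (\<integral>\<^sup>+\<omega>. (\<integral>\<^sup>+x. (if next_cell \<pi> (upd_cell \<omega> i x) t = i then F (upd_cell \<omega> i x) (fst (upd_cell \<omega> i x) i) else 0)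
          \<partial>arm_law \<theta> (fst i)) \<partial>bandit_space \<theta>)"
      by (rule nn_integral_resample) measurable
    also have "\<dots> = (\<integral>\<^sup>+\<omega>. (if next_cell \<pi> \<omega> t = i then \<integral>\<^sup>+y. F \<omega> y \<partial>arm_law \<theta> (fst i) else 0) \<partial>bandit_space \<theta>)"
      by (intro nn_integral_cong)
         (auto simp: next_cell_upd_cell_iff determined_at_upd_next_cell[OF det], simp add: upd_cell_def)
    finally show "(\<integral>\<^sup>+\<omega>. (if next_cell \<pi> \<omega> t = i then F \<omega> (fst \<omega> i) else 0) \<partial>bandit_space \<theta>) = \<dots>" .
  qed
  also have "\<dots> = (\<integral>\<^sup>+\<omega>. (\<Sum>i\<in>A. if next_cell \<pi> \<omega> t = i then \<integral>\<^sup>+y. F \<omega> y \<partial>arm_law \<theta> (fst i) else 0) \<partial>bandit_space \<theta>)"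
    by (rule nn_integral_sum[symmetric]) measurable
  also have "\<dots> = (\<integral>\<^sup>+\<omega>. (\<integral>\<^sup>+y. F \<omega> y \<partial>arm_law \<theta> (fst (next_cell \<pi> \<omega> t))) \<partial>bandit_space \<theta>)"
    by (intro nn_integral_cong) (rule split[symmetric])
  finally show ?thesis by (simp add: next_cell_def)
qed

end

subsection \<open>Change of measure and Wald's identity\<close>

text \<open>The logarithm of the density of arm \<open>a\<close> under \<open>\<theta>\<close> over
  its density under \<open>\<eta>\<close>. Its mean under \<open>\<theta>\<close> is the relative
  entropy of the two Gaussian laws.\<close>

definition llr :: "real^'k::finite \<Rightarrow> real^'k \<Rightarrow> 'k \<Rightarrow> real \<Rightarrow> real" where
  "llr \<theta> \<eta> a x = ((x - \<eta> $ a)\<^sup>2 - (x - \<theta> $ a)\<^sup>2) / 2"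

lemma llr_measurable [measurable]: "llr \<theta> \<eta> a \<in> borel_measurable borel"
  unfolding llr_def by measurable

lemma normal_density_eq_exp_llr:
  "normal_density (\<eta> $ a) 1 x = normal_density (\<theta> $ a) 1 x * exp (- llr \<theta> \<eta> a x)"
  by (simp add: normal_density_def llr_def flip: exp_add) (simp add: field_simps)

lemma nn_integral_arm_law_change:
  assumes [measurable]: "f \<in> borel_measurable borel"
  shows "(\<integral>\<^sup>+x. f x \<partial>arm_law \<eta> a) = (\<integral>\<^sup>+x. f x * ennreal (exp (- llr \<theta> \<eta> a x)) \<partial>arm_law \<theta> a)"
proof -
  have "(\<integral>\<^sup>+x. f x \<partial>arm_law \<eta> a) = (\<integral>\<^sup>+x. ennreal (normal_density (\<eta> $ a) 1 x) * f x \<partial>lborel)"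
    by (rule nn_integral_arm_law) measurable
  also have "\<dots> = (\<integral>\<^sup>+x. ennreal (normal_density (\<theta> $ a) 1 x) * (f x * ennreal (exp (- llr \<theta> \<eta> a x))) \<partial>lborel)"
    by (intro nn_integral_cong, subst normal_density_eq_exp_llr[of \<eta> _ _ \<theta>])
       (simp add: ennreal_mult ac_simps)
  also have "\<dots> = (\<integral>\<^sup>+x. f x * ennreal (exp (- llr \<theta> \<eta> a x)) \<partial>arm_law \<theta> a)"
    by (rule nn_integral_arm_law[symmetric]) measurable
  finally show ?thesis .
qed

text \<open>With \<open>d = \<theta> $ a - \<eta> $ a\<close> the function equals
  \<open>d * (x - \<theta> $ a) + d^2 / 2\<close>, and the linear term is an odd central
  moment.\<close>

lemma has_bochner_integral_llr:
  "has_bochner_integral (arm_law \<theta> a) (llr \<theta> \<eta> a) ((\<theta> $ a - \<eta> $ a)\<^sup>2 / 2)"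
proof -
  let ?\<mu> = "\<theta> $ a" and ?d = "\<theta> $ a - \<eta> $ a"
  have 0: "has_bochner_integral lborel (\<lambda>x. normal_density ?\<mu> 1 x * (x - ?\<mu>) ^ (2 * 0 + 1)) 0"
    by (rule normal_moment_odd) simp
  have 1: "has_bochner_integral lborel (normal_density ?\<mu> 1) 1"
    by (simp add: has_bochner_integral_iff)
  have "has_bochner_integral lborel
      (\<lambda>x. ?d * (normal_density ?\<mu> 1 x * (x - ?\<mu>) ^ (2 * 0 + 1)) + ?d\<^sup>2 / 2 * normal_density ?\<mu> 1 x)
      (?d * 0 + ?d\<^sup>2 / 2 * 1)"
    by (intro has_bochner_integral_add has_bochner_integral_mult_right 0 1)
  also have "(\<lambda>x. ?d * (normal_density ?\<mu> 1 x * (x - ?\<mu>) ^ (2 * 0 + 1)) + ?d\<^sup>2 / 2 * normal_density ?\<mu> 1 x)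
      = (\<lambda>x. normal_density ?\<mu> 1 x *\<^sub>R llr \<theta> \<eta> a x)"
    by (rule ext) (simp add: llr_def power2_eq_square field_simps)
  finally show ?thesis
    unfolding arm_law_def by (intro has_bochner_integral_density) (auto simp: normal_density_nonneg)
qed

definition log_lik :: "('k::finite hist \<Rightarrow> (nat \<Rightarrow> real) \<Rightarrow> 'k) \<Rightarrow> real^'k \<Rightarrow> real^'k \<Rightarrow> 'k omega \<Rightarrow> nat \<Rightarrow> real" where
  "log_lik \<pi> \<theta> \<eta> \<omega> t = (\<Sum>s<t. llr \<theta> \<eta> (arm_at \<pi> \<omega> s) (reward_at \<pi> \<omega> s))"

lemma exp_log_lik_Suc:
  "exp (- log_lik \<pi> \<theta> \<eta> \<omega> (Suc t)) =
    exp (- llr \<theta> \<eta> (arm_at \<pi> \<omega> t) (reward_at \<pi> \<omega> t)) * exp (- log_lik \<pi> \<theta> \<eta> \<omega> t)"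
  by (subst exp_add[symmetric]) (simp add: log_lik_def)

lemma determined_at_log_lik: "determined_at \<pi> t (\<lambda>\<omega>. log_lik \<pi> \<theta> \<eta> \<omega> t)"
proof (rule determined_atI)
  fix \<omega> \<omega>' assume h: "hist \<pi> \<omega> t = hist \<pi> \<omega>' t"
  have "(arm_at \<pi> \<omega> s, reward_at \<pi> \<omega> s) = (arm_at \<pi> \<omega>' s, reward_at \<pi> \<omega>' s)" if "s < t" for s
    using nth_hist[OF that, of \<pi>] h by metis
  then show "log_lik \<pi> \<theta> \<eta> \<omega> t = log_lik \<pi> \<theta> \<eta> \<omega>' t"
    unfolding log_lik_def by (intro sum.cong) auto
qed

section \<open>Stopping times\<close>

lemma stop_time_eq_iff:
  "stop_time \<pi> stop \<omega> = enat t \<longleftrightarrow> stop (hist \<pi> \<omega> t) \<and> (\<forall>s<t. \<not> stop (hist \<pi> \<omega> s))"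
proof
  assume "stop_time \<pi> stop \<omega> = enat t"
  then have ex: "\<exists>t. stop (hist \<pi> \<omega> t)" and t: "t = (LEAST t. stop (hist \<pi> \<omega> t))"
    by (auto simp: stop_time_def split: if_splits)
  show "stop (hist \<pi> \<omega> t) \<and> (\<forall>s<t. \<not> stop (hist \<pi> \<omega> s))"
    using LeastI_ex[OF ex] not_less_Least[where P="\<lambda>t. stop (hist \<pi> \<omega> t)"] t by blast
next
  assume *: "stop (hist \<pi> \<omega> t) \<and> (\<forall>s<t. \<not> stop (hist \<pi> \<omega> s))"
  then have "(LEAST t. stop (hist \<pi> \<omega> t)) = t"
    by (intro Least_equality) (simp, rule leI, blast)
  moreover have "\<exists>t. stop (hist \<pi> \<omega> t)" using * by blast
  ultimately show "stop_time \<pi> stop \<omega> = enat t"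
    by (simp add: stop_time_def)
qed

text \<open>Whether the round with index \<open>t\<close> takes place is settled by the history of
  length \<open>t\<close>, hence before the reward of that round is drawn. Wald's identity depends
  on this.\<close>

lemma less_stop_time_iff: "enat t < stop_time \<pi> stop \<omega> \<longleftrightarrow> (\<forall>s\<le>t. \<not> stop (hist \<pi> \<omega> s))"
proof (cases "stop_time \<pi> stop \<omega>")
  case (enat n)
  then have "stop (hist \<pi> \<omega> n)" "\<forall>s<n. \<not> stop (hist \<pi> \<omega> s)"
    by (auto simp: stop_time_eq_iff)
  then have "t < n \<longleftrightarrow> (\<forall>s\<le>t. \<not> stop (hist \<pi> \<omega> s))"
    by (meson le_less_trans not_less)
  then show ?thesis using enat by simp
next
  case infinity
  then have "\<nexists>t. stop (hist \<pi> \<omega> t)" by (auto simp: stop_time_def split: if_splits)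
  then show ?thesis using infinity by simp
qed

lemma determined_at_hist_prefix: "s \<le> t \<Longrightarrow> determined_at \<pi> t (\<lambda>\<omega>. hist \<pi> \<omega> s)"
  using determined_at_mono[OF determined_at_hist] .

lemma determined_at_stop_before:
  "determined_at \<pi> t (\<lambda>\<omega>. \<forall>s\<le>t. \<not> stop (hist \<pi> \<omega> s))"
  "determined_at \<pi> t (\<lambda>\<omega>. \<forall>s<t. \<not> stop (hist \<pi> \<omega> s))"
proof -
  have eq: "hist \<pi> \<omega> s = hist \<pi> \<omega>' s"
    if "s \<le> t" "hist \<pi> \<omega> t = hist \<pi> \<omega>' t" "snd \<omega> = snd \<omega>'" for \<omega> \<omega>' s
    using determined_atD[OF determined_at_hist_prefix[OF that(1)] that(2,3)] .
  show "determined_at \<pi> t (\<lambda>\<omega>. \<forall>s\<le>t. \<not> stop (hist \<pi> \<omega> s))"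
  proof (rule determined_atI)
    fix \<omega> \<omega>' assume h: "hist \<pi> \<omega> t = hist \<pi> \<omega>' t" "snd \<omega> = snd \<omega>'"
    show "(\<forall>s\<le>t. \<not> stop (hist \<pi> \<omega> s)) = (\<forall>s\<le>t. \<not> stop (hist \<pi> \<omega>' s))"
      using eq[OF _ h] by auto
  qed
  show "determined_at \<pi> t (\<lambda>\<omega>. \<forall>s<t. \<not> stop (hist \<pi> \<omega> s))"
  proof (rule determined_atI)
    fix \<omega> \<omega>' assume h: "hist \<pi> \<omega> t = hist \<pi> \<omega>' t" "snd \<omega> = snd \<omega>'"
    show "(\<forall>s<t. \<not> stop (hist \<pi> \<omega> s)) = (\<forall>s<t. \<not> stop (hist \<pi> \<omega>' s))"
      using eq[OF less_imp_le h] by auto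
  qed
qed

lemma suminf_stop_time:
  fixes f :: "nat \<Rightarrow> ennreal"
  shows "(\<Sum>t. if \<tau> = enat t then f t else 0) = (if \<tau> < \<infinity> then f (the_enat \<tau>) else 0)"
proof (cases \<tau>)
  case (enat n)
  then have "(\<lambda>t. if \<tau> = enat t then f t else 0) = (\<lambda>t. if t = n then f t else 0)" by auto
  then show ?thesis using enat sums_unique[OF sums_single[of n f], symmetric] by simp
qed simp

lemma suminf_before_enat:
  fixes f :: "nat \<Rightarrow> ennreal"
  shows "(\<Sum>t. if enat t < enat n then f t else 0) = (\<Sum>t<n. f t)"
  by (subst suminf_finite[of "{..<n}"]) auto

lemma ennreal_of_enat_eq_suminf: "ennreal_of_enat \<tau> = (\<Sum>t. if enat t < \<tau> then 1 else 0)"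
proof (cases \<tau>)
  case (enat n)
  then show ?thesis by (simp only: suminf_before_enat) simp
next
  case infinity
  then show ?thesis by (simp add: suminf_eq_SUP ennreal_SUP_of_nat_eq_top)
qed

section \<open>Change of measure and Wald's identity for a fixed algorithm\<close>

context bandit_alg
begin

lemma measurable_llr_arm_at [measurable]:
  assumes [measurable]: "f \<in> measurable M outcome_borel" "g \<in> borel_measurable M"
  shows "(\<lambda>z. llr \<theta> \<eta> (arm_at \<pi> (f z) t) (g z)) \<in> borel_measurable M"
  by (rule measurable_compose_countable[where f="\<lambda>a z. llr \<theta> \<eta> a (g z)"]) measurable

lemma measurable_log_lik [measurable]: "(\<lambda>\<omega>. log_lik \<pi> \<theta> \<eta> \<omega> t) \<in> borel_measurable outcome_borel"
  unfolding log_lik_def by measurable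

text \<open>The induction peels off the last reward: integrating it out under \<open>\<eta>\<close>
  leaves a function of one observation fewer, to which the induction hypothesis applies. The density
  ratio of the last reward then turns its law into the one under \<open>\<theta>\<close>, and the
  reward is put back. Without observations only the seeds remain, and their law does not depend on
  the parameter.\<close>

lemma change_of_measure:
  assumes "G \<in> borel_measurable outcome_borel" "determined_at \<pi> t G"
  shows "(\<integral>\<^sup>+\<omega>. G \<omega> \<partial>bandit_space \<eta>) =
    (\<integral>\<^sup>+\<omega>. G \<omega> * ennreal (exp (- log_lik \<pi> \<theta> \<eta> \<omega> t)) \<partial>bandit_space \<theta>)"
  using assms
proof (induction t arbitrary: G)
  case (0 G)
  have G0: "G (r, s) = G (undefined, s)" for r s
    using 0(2) by (rule determined_atD) auto
  have "(\<integral>\<^sup>+\<omega>. G \<omega> \<partial>bandit_space \<eta>) = (\<integral>\<^sup>+s. G (undefined, s) \<partial>seed_space)" for \<eta>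
  proof -
    interpret R: prob_space "reward_space \<eta>" by (rule prob_space_reward_space)
    interpret S: prob_space seed_space by (rule prob_space_seed_space)
    interpret RS: pair_prob_space "reward_space \<eta>" seed_space ..
    have "G \<in> borel_measurable (bandit_space \<eta>)"
      using 0(1) by (simp add: measurable_cong_sets[OF sets_bandit_space refl])
    then have "(\<integral>\<^sup>+\<omega>. G \<omega> \<partial>bandit_space \<eta>) = (\<integral>\<^sup>+s. \<integral>\<^sup>+r. G (r, s) \<partial>reward_space \<eta> \<partial>seed_space)"
      unfolding bandit_space_def by (rule RS.nn_integral_snd[symmetric])
    then show ?thesis by (subst (asm) G0) (simp add: R.emeasure_space_1)
  qed
  then show ?case by (simp add: log_lik_def)
next
  case (Suc t G)
  note [measurable] = Suc.prems(1)
  note det = Suc.prems(2)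
  \<comment> \<open>The last reward becomes a free argument \<open>y\<close>: as a function of
    \<open>y\<close>, the value of \<open>G\<close> is already fixed by the first \<open>t\<close>
    observations.\<close>
  define U where "U \<omega> y = G (upd_cell \<omega> (next_cell \<pi> \<omega> t) y)" for \<omega> y
  have U [measurable]: "(\<lambda>z. U (fst z) (snd z)) \<in> borel_measurable (outcome_borel \<Otimes>\<^sub>M borel)"
    unfolding U_def by (rule measurable_compose[OF measurable_upd_next_cell Suc.prems(1)])
  have U1 [measurable]: "U \<omega> \<in> borel_measurable borel" for \<omega>
    using measurable_compose[OF _ U, of "\<lambda>y. (\<omega>, y)" borel] by simp
  have detU: "determined_at \<pi> t U"
  proof (rule determined_atI, rule ext)
    fix \<omega> \<omega>' y assume "hist \<pi> \<omega> t = hist \<pi> \<omega>' t" "snd \<omega> = snd \<omega>'"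
    then show "U \<omega> y = U \<omega>' y"
      unfolding U_def by (intro determined_atD[OF det])
        (auto simp: hist_Suc_upd_next_cell arm_at_def, simp add: upd_cell_def)
  qed
  have U_reward: "U \<omega> (reward_at \<pi> \<omega> t) = G \<omega>" for \<omega>
    by (simp add: U_def reward_at_def)
  define H where "H \<omega> = (\<integral>\<^sup>+y. U \<omega> y \<partial>arm_law \<eta> (arm_at \<pi> \<omega> t))" for \<omega>
  have H [measurable]: "H \<in> borel_measurable outcome_borel"
    unfolding H_def
  proof (rule measurable_compose_countable[OF _ measurable_arm_at])
    fix a
    interpret N: prob_space "arm_law \<eta> a" by (rule prob_space_arm_law)
    show "(\<lambda>\<omega>. \<integral>\<^sup>+y. U \<omega> y \<partial>arm_law \<eta> a) \<in> borel_measurable outcome_borel"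
      by (rule N.borel_measurable_nn_integral) (simp only: case_prod_beta', measurable)
  qed
  have detH: "determined_at \<pi> t H"
    unfolding H_def by (rule determined_at_comp2[OF detU determined_at_arm_at])
  let ?L = "\<lambda>t \<omega>. ennreal (exp (- log_lik \<pi> \<theta> \<eta> \<omega> t))"
  let ?l = "\<lambda>\<omega> y. ennreal (exp (- llr \<theta> \<eta> (arm_at \<pi> \<omega> t) y))"
  define F where "F \<omega> y = U \<omega> y * ?l \<omega> y * ?L t \<omega>" for \<omega> y
  have F: "(\<lambda>z. F (fst z) (snd z)) \<in> borel_measurable (outcome_borel \<Otimes>\<^sub>M borel)"
    unfolding F_def by measurable
  have detF: "determined_at \<pi> t F"
  proof (rule determined_atI)
    fix \<omega> \<omega>' assume h: "hist \<pi> \<omega> t = hist \<pi> \<omega>' t" "snd \<omega> = snd \<omega>'"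
    show "F \<omega> = F \<omega>'"
      unfolding F_def
      by (simp add: determined_atD[OF detU h] determined_atD[OF determined_at_arm_at h]
           determined_atD[OF determined_at_log_lik h])
  qed
  have "(\<integral>\<^sup>+\<omega>. G \<omega> \<partial>bandit_space \<eta>) = (\<integral>\<^sup>+\<omega>. U \<omega> (reward_at \<pi> \<omega> t) \<partial>bandit_space \<eta>)"
    by (simp add: U_reward)
  also have "\<dots> = (\<integral>\<^sup>+\<omega>. H \<omega> \<partial>bandit_space \<eta>)"
    unfolding H_def by (rule nn_integral_reward_at[OF U detU])
  also have "\<dots> = (\<integral>\<^sup>+\<omega>. H \<omega> * ?L t \<omega> \<partial>bandit_space \<theta>)"
    by (rule Suc.IH[OF H detH])
  also have "\<dots> = (\<integral>\<^sup>+\<omega>. (\<integral>\<^sup>+y. F \<omega> y \<partial>arm_law \<theta> (arm_at \<pi> \<omega> t)) \<partial>bandit_space \<theta>)"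
  proof (intro nn_integral_cong)
    fix \<omega>
    have "H \<omega> * ?L t \<omega> = (\<integral>\<^sup>+y. U \<omega> y * ?l \<omega> y \<partial>arm_law \<theta> (arm_at \<pi> \<omega> t)) * ?L t \<omega>"
      unfolding H_def by (subst nn_integral_arm_law_change[of _ _ _ \<theta>]) auto
    also have "\<dots> = (\<integral>\<^sup>+y. F \<omega> y \<partial>arm_law \<theta> (arm_at \<pi> \<omega> t))"
      unfolding F_def by (rule nn_integral_multc[symmetric]) measurable
    finally show "H \<omega> * ?L t \<omega> = \<dots>" .
  qed
  also have "\<dots> = (\<integral>\<^sup>+\<omega>. F \<omega> (reward_at \<pi> \<omega> t) \<partial>bandit_space \<theta>)"
    by (rule nn_integral_reward_at[OF F detF, symmetric])
  also have "\<dots> = (\<integral>\<^sup>+\<omega>. G \<omega> * ?L (Suc t) \<omega> \<partial>bandit_space \<theta>)"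
    by (intro nn_integral_cong)
       (simp add: F_def U_reward exp_log_lik_Suc ennreal_mult' mult.assoc)
  finally show ?case .
qed

abbreviation "\<tau> \<equiv> stop_time \<pi> stop"

definition decides :: "('k \<Rightarrow> bool) \<Rightarrow> 'k omega \<Rightarrow> bool" where
  "decides D \<omega> \<longleftrightarrow> \<tau> \<omega> < \<infinity> \<and> D (dec (hist \<pi> \<omega> (the_enat (\<tau> \<omega>))))"

lemma measurable_stop_time_eq [measurable]: "Measurable.pred outcome_borel (\<lambda>\<omega>. \<tau> \<omega> = enat t)"
  unfolding stop_time_eq_iff by measurable

lemma measurable_less_stop_time [measurable]: "Measurable.pred outcome_borel (\<lambda>\<omega>. enat t < \<tau> \<omega>)"
  unfolding less_stop_time_iff by measurable

lemma finite_stop_time_iff: "\<tau> \<omega> < \<infinity> \<longleftrightarrow> (\<exists>t. \<tau> \<omega> = enat t)"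
  by (cases "\<tau> \<omega>") auto

lemma measurable_finite_stop_time [measurable]: "Measurable.pred outcome_borel (\<lambda>\<omega>. \<tau> \<omega> < \<infinity>)"
  unfolding finite_stop_time_iff by measurable

lemma decides_iff: "decides D \<omega> \<longleftrightarrow> (\<exists>t. \<tau> \<omega> = enat t \<and> D (dec (hist \<pi> \<omega> t)))"
  by (cases "\<tau> \<omega>") (auto simp: decides_def)

lemma measurable_decides [measurable]: "Measurable.pred outcome_borel (decides D)"
proof -
  have [measurable]: "Measurable.pred outcome_borel (\<lambda>\<omega>. D (dec (hist \<pi> \<omega> t)))" for t
    by (rule measurable_compose[OF measurable_dec]) simp
  show ?thesis unfolding decides_iff[abs_def] by measurable
qed

text \<open>On \<open>\<tau> \<omega> = enat t\<close> both the stopping and the decision are fixed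
  by the first \<open>t\<close> observations, so the change of measure at time \<open>t\<close>
  applies to each value of the stopping time separately.\<close>

lemma change_of_measure_decides:
  "emeasure (bandit_space \<eta>) {\<omega>. decides D \<omega>} =
   (\<integral>\<^sup>+\<omega>. indicator {\<omega>. decides D \<omega>} \<omega> * ennreal (exp (- log_lik \<pi> \<theta> \<eta> \<omega> (the_enat (\<tau> \<omega>)))) \<partial>bandit_space \<theta>)"
proof -
  have [measurable]: "Measurable.pred outcome_borel (\<lambda>\<omega>. D (dec (hist \<pi> \<omega> t)))" for t
    by (rule measurable_compose[OF measurable_dec]) simp
  define I where "I t \<omega> = (if \<tau> \<omega> = enat t \<and> D (dec (hist \<pi> \<omega> t)) then 1 else 0 :: ennreal)" for t \<omega>
  have I [measurable]: "I t \<in> borel_measurable outcome_borel" for t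
    unfolding I_def by measurable
  have detI: "determined_at \<pi> t (I t)" for t
  proof (rule determined_atI)
    fix \<omega> \<omega>' assume h: "hist \<pi> \<omega> t = hist \<pi> \<omega>' t" "snd \<omega> = snd \<omega>'"
    show "I t \<omega> = I t \<omega>'"
      unfolding I_def stop_time_eq_iff
      using determined_atD[OF determined_at_stop_before(2) h, of stop] h(1) by simp
  qed
  have ind: "indicator {\<omega>. decides D \<omega>} \<omega> * f (the_enat (\<tau> \<omega>)) = (\<Sum>t. I t \<omega> * f t)"
    for \<omega> and f :: "nat \<Rightarrow> ennreal"
  proof -
    have "(\<Sum>t. I t \<omega> * f t) = (\<Sum>t. if \<tau> \<omega> = enat t then (if D (dec (hist \<pi> \<omega> t)) then f t else 0) else 0)"
      by (intro arg_cong[where f=suminf]) (auto simp: I_def)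
    then show ?thesis
      by (simp add: suminf_stop_time decides_def split: split_indicator)
  qed
  have "{\<omega> \<in> space outcome_borel. decides D \<omega>} \<in> sets outcome_borel"
    by measurable
  then have "emeasure (bandit_space \<eta>) {\<omega>. decides D \<omega>} = (\<integral>\<^sup>+\<omega>. indicator {\<omega>. decides D \<omega>} \<omega> * 1 \<partial>bandit_space \<eta>)"
    by simp
  also have "\<dots> = (\<integral>\<^sup>+\<omega>. (\<Sum>t. I t \<omega>) \<partial>bandit_space \<eta>)"
    using ind[of _ "\<lambda>_. 1"] by simp
  also have "\<dots> = (\<Sum>t. \<integral>\<^sup>+\<omega>. I t \<omega> \<partial>bandit_space \<eta>)"
    by (rule nn_integral_suminf) measurable
  also have "\<dots> = (\<Sum>t. \<integral>\<^sup>+\<omega>. I t \<omega> * ennreal (exp (- log_lik \<pi> \<theta> \<eta> \<omega> t)) \<partial>bandit_space \<theta>)"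
    by (intro arg_cong[where f=suminf] ext change_of_measure I detI)
  also have "\<dots> = (\<integral>\<^sup>+\<omega>. (\<Sum>t. I t \<omega> * ennreal (exp (- log_lik \<pi> \<theta> \<eta> \<omega> t))) \<partial>bandit_space \<theta>)"
    by (rule nn_integral_suminf[symmetric]) measurable
  also have "(\<lambda>\<omega>. \<Sum>t. I t \<omega> * ennreal (exp (- log_lik \<pi> \<theta> \<eta> \<omega> t))) =
      (\<lambda>\<omega>. indicator {\<omega>. decides D \<omega>} \<omega> * ennreal (exp (- log_lik \<pi> \<theta> \<eta> \<omega> (the_enat (\<tau> \<omega>)))))"
    by (rule ext, rule ind[symmetric])
  finally show ?thesis .
qed

lemma measurable_pulls_at_stop [measurable]: "pulls_at_stop \<pi> stop a \<in> borel_measurable outcome_borel"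
  unfolding pulls_at_stop_def by measurable

lemma exp_tau_eq_sum_exp_pulls: "exp_tau \<theta> \<pi> stop = (\<Sum>a\<in>UNIV. exp_pulls \<theta> \<pi> stop a)"
proof -
  have "ennreal_of_enat (\<tau> \<omega>) = (\<Sum>a\<in>UNIV. pulls_at_stop \<pi> stop a \<omega>)" for \<omega>
  proof -
    have "(\<Sum>a\<in>UNIV. pulls_at_stop \<pi> stop a \<omega>)
        = (\<Sum>t. \<Sum>a\<in>UNIV. if enat t < \<tau> \<omega> \<and> arm_at \<pi> \<omega> t = a then 1 else 0)"
      unfolding pulls_at_stop_def by (rule suminf_sum[symmetric]) simp
    also have "\<dots> = (\<Sum>t. if enat t < \<tau> \<omega> then 1 else 0)"
      by (intro arg_cong[where f=suminf] ext) simp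
    finally show ?thesis by (simp add: ennreal_of_enat_eq_suminf)
  qed
  then show ?thesis
    unfolding exp_tau_def exp_pulls_def by (simp add: nn_integral_sum)
qed

text \<open>The arm and the event that the round takes place are known before the reward, so
  integrating the reward replaces \<open>g\<close> by its mean for that arm. For nonnegative
  \<open>g\<close> all exchanges of sum and integral hold without integrability assumptions.\<close>

lemma wald:
  fixes g :: "'k \<Rightarrow> real \<Rightarrow> ennreal"
  assumes g [measurable]: "\<And>a. g a \<in> borel_measurable borel"
  shows "(\<integral>\<^sup>+\<omega>. (\<Sum>t. if enat t < \<tau> \<omega> then g (arm_at \<pi> \<omega> t) (reward_at \<pi> \<omega> t) else 0) \<partial>bandit_space \<theta>)
    = (\<Sum>a\<in>UNIV. exp_pulls \<theta> \<pi> stop a * (\<integral>\<^sup>+x. g a x \<partial>arm_law \<theta> a))"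
proof -
  define m where "m a = (\<integral>\<^sup>+x. g a x \<partial>arm_law \<theta> a)" for a
  have [measurable]: "(\<lambda>z. g (arm_at \<pi> (fst z) t) (snd z)) \<in> borel_measurable (outcome_borel \<Otimes>\<^sub>M borel)" for t
    by (rule measurable_compose_countable[where f="\<lambda>a z. g a (snd z)"]) measurable
  have [measurable]: "(\<lambda>\<omega>. g (arm_at \<pi> \<omega> t) (reward_at \<pi> \<omega> t)) \<in> borel_measurable outcome_borel" for t
    by (rule measurable_compose_countable[where f="\<lambda>a \<omega>. g a (reward_at \<pi> \<omega> t)"]) measurable
  have step: "(\<integral>\<^sup>+\<omega>. (if enat t < \<tau> \<omega> then g (arm_at \<pi> \<omega> t) (reward_at \<pi> \<omega> t) else 0) \<partial>bandit_space \<theta>)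
      = (\<integral>\<^sup>+\<omega>. (\<Sum>a\<in>UNIV. (if enat t < \<tau> \<omega> \<and> arm_at \<pi> \<omega> t = a then 1 else 0) * m a) \<partial>bandit_space \<theta>)" for t
  proof -
    define F where "F \<omega> y = (if enat t < \<tau> \<omega> then g (arm_at \<pi> \<omega> t) y else 0)" for \<omega> y
    have F: "(\<lambda>z. F (fst z) (snd z)) \<in> borel_measurable (outcome_borel \<Otimes>\<^sub>M borel)"
      unfolding F_def by measurable
    have detF: "determined_at \<pi> t F"
    proof (rule determined_atI)
      fix \<omega> \<omega>' assume h: "hist \<pi> \<omega> t = hist \<pi> \<omega>' t" "snd \<omega> = snd \<omega>'"
      show "F \<omega> = F \<omega>'"
        unfolding F_def less_stop_time_iff
        by (rule ext) (auto simp: determined_atD[OF determined_at_stop_before(1) h] determined_atD[OF determined_at_arm_at h])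
    qed
    have "(\<integral>\<^sup>+\<omega>. F \<omega> (reward_at \<pi> \<omega> t) \<partial>bandit_space \<theta>) =
        (\<integral>\<^sup>+\<omega>. (\<integral>\<^sup>+y. F \<omega> y \<partial>arm_law \<theta> (arm_at \<pi> \<omega> t)) \<partial>bandit_space \<theta>)"
      by (rule nn_integral_reward_at[OF F detF])
    also have "\<dots> = (\<integral>\<^sup>+\<omega>. (\<Sum>a\<in>UNIV. (if enat t < \<tau> \<omega> \<and> arm_at \<pi> \<omega> t = a then 1 else 0) * m a) \<partial>bandit_space \<theta>)"
    proof (intro nn_integral_cong)
      fix \<omega>
      show "(\<integral>\<^sup>+y. F \<omega> y \<partial>arm_law \<theta> (arm_at \<pi> \<omega> t)) =
          (\<Sum>a\<in>UNIV. (if enat t < \<tau> \<omega> \<and> arm_at \<pi> \<omega> t = a then 1 else 0) * m a)"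
        by (cases "enat t < \<tau> \<omega>")
           (simp_all add: F_def m_def if_distrib[of "\<lambda>x. x * _"] cong: if_cong)
    qed
    finally show ?thesis unfolding F_def .
  qed
  have "(\<integral>\<^sup>+\<omega>. (\<Sum>t. if enat t < \<tau> \<omega> then g (arm_at \<pi> \<omega> t) (reward_at \<pi> \<omega> t) else 0) \<partial>bandit_space \<theta>)
    = (\<Sum>t. \<integral>\<^sup>+\<omega>. (if enat t < \<tau> \<omega> then g (arm_at \<pi> \<omega> t) (reward_at \<pi> \<omega> t) else 0) \<partial>bandit_space \<theta>)"
    by (rule nn_integral_suminf) measurable
  also have "\<dots> = (\<Sum>t. \<integral>\<^sup>+\<omega>. (\<Sum>a\<in>UNIV. (if enat t < \<tau> \<omega> \<and> arm_at \<pi> \<omega> t = a then 1 else 0) * m a) \<partial>bandit_space \<theta>)"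
    by (simp only: step)
  also have "\<dots> = (\<integral>\<^sup>+\<omega>. (\<Sum>t. \<Sum>a\<in>UNIV. (if enat t < \<tau> \<omega> \<and> arm_at \<pi> \<omega> t = a then 1 else 0) * m a) \<partial>bandit_space \<theta>)"
    by (rule nn_integral_suminf[symmetric]) measurable
  also have "\<dots> = (\<integral>\<^sup>+\<omega>. (\<Sum>a\<in>UNIV. pulls_at_stop \<pi> stop a \<omega> * m a) \<partial>bandit_space \<theta>)"
    unfolding pulls_at_stop_def by (intro nn_integral_cong) (subst suminf_sum, auto)
  also have "\<dots> = (\<Sum>a\<in>UNIV. exp_pulls \<theta> \<pi> stop a * m a)"
    unfolding exp_pulls_def by (simp add: nn_integral_sum nn_integral_multc)
  finally show ?thesis by (simp add: m_def)
qed

end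

section \<open>Expected log-likelihood ratio and the transportation inequality\<close>

lemma has_bochner_integral_enn2real:
  assumes f [measurable]: "f \<in> borel_measurable M" and fin: "(\<integral>\<^sup>+x. f x \<partial>M) < \<infinity>"
  shows "has_bochner_integral M (\<lambda>x. enn2real (f x)) (enn2real (\<integral>\<^sup>+x. f x \<partial>M))"
proof (rule has_bochner_integral_nn_integral)
  have "AE x in M. f x \<noteq> \<infinity>"
    by (rule nn_integral_noteq_infinite) (use fin in auto)
  then have "(\<integral>\<^sup>+x. ennreal (enn2real (f x)) \<partial>M) = (\<integral>\<^sup>+x. f x \<partial>M)"
    by (intro nn_integral_cong_AE) (auto simp: less_top)
  then show "(\<integral>\<^sup>+x. ennreal (enn2real (f x)) \<partial>M) = ennreal (enn2real (\<integral>\<^sup>+x. f x \<partial>M))"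
    using fin by (simp add: less_top)
qed auto

lemma enn2real_sum:
  assumes "\<And>x. x \<in> A \<Longrightarrow> f x < \<infinity>"
  shows "enn2real (\<Sum>x\<in>A. f x) = (\<Sum>x\<in>A. enn2real (f x))"
  using assms
proof (induction A rule: infinite_finite_induct)
  case (insert x A)
  then have "(\<Sum>x\<in>A. f x) < \<infinity>" by (simp add: less_top)
  then show ?case using insert by (simp add: enn2real_plus)
qed auto

context bandit_alg
begin

lemma measurable_the_stop_time [measurable]:
  "(\<lambda>\<omega>. the_enat (\<tau> \<omega>)) \<in> measurable outcome_borel (count_space UNIV)"
proof -
  have "(\<lambda>\<omega>. the_enat (\<tau> \<omega>)) =
      (\<lambda>\<omega>. if \<tau> \<omega> < \<infinity> then (LEAST t. stop (hist \<pi> \<omega> t)) else the_enat \<infinity>)"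
    by (auto simp: stop_time_def fun_eq_iff)
  moreover have "\<dots> \<in> measurable outcome_borel (count_space UNIV)"
    by measurable
  ultimately show ?thesis by simp
qed

lemma measurable_log_lik_stop [measurable]:
  "(\<lambda>\<omega>. log_lik \<pi> \<theta> \<eta> \<omega> (the_enat (\<tau> \<omega>))) \<in> borel_measurable outcome_borel"
  by (rule measurable_compose_countable[OF measurable_log_lik measurable_the_stop_time])

lemma exp_pulls_finite: "exp_tau \<theta> \<pi> stop < \<infinity> \<Longrightarrow> exp_pulls \<theta> \<pi> stop a < \<infinity>"
  by (auto simp: exp_tau_eq_sum_exp_pulls less_top)

lemma expectation_log_lik:
  assumes fin: "exp_tau \<theta> \<pi> stop < \<infinity>" and AE_stop: "AE \<omega> in bandit_space \<theta>. \<tau> \<omega> < \<infinity>"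
  shows "has_bochner_integral (bandit_space \<theta>) (\<lambda>\<omega>. log_lik \<pi> \<theta> \<eta> \<omega> (the_enat (\<tau> \<omega>)))
    (\<Sum>a\<in>UNIV. enn2real (exp_pulls \<theta> \<pi> stop a) * ((\<theta> $ a - \<eta> $ a)\<^sup>2 / 2))"
proof -
  \<comment> \<open>\<open>ennreal\<close> cuts negative values to zero, so
    \<open>\<sigma> = 1\<close> and \<open>\<sigma> = -1\<close> select the positive and the
    negative part of the log-likelihood ratio, in \<open>m\<close> for one reward and in
    \<open>V\<close> for the whole run. Wald's identity applies to each part, and both are
    finite.\<close>
  define m where "m \<sigma> a = (\<integral>\<^sup>+x. ennreal (\<sigma> * llr \<theta> \<eta> a x) \<partial>arm_law \<theta> a)" for \<sigma> a
  define V where "V \<sigma> \<omega> = (\<Sum>t. if enat t < \<tau> \<omega>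
      then ennreal (\<sigma> * llr \<theta> \<eta> (arm_at \<pi> \<omega> t) (reward_at \<pi> \<omega> t)) else 0)" for \<sigma> \<omega>
  have V [measurable]: "V \<sigma> \<in> borel_measurable outcome_borel" for \<sigma>
    unfolding V_def by measurable
  have int: "integrable (arm_law \<theta> a) (llr \<theta> \<eta> a)"
    and mean: "(\<integral>x. llr \<theta> \<eta> a x \<partial>arm_law \<theta> a) = (\<theta> $ a - \<eta> $ a)\<^sup>2 / 2" for a
    using has_bochner_integral_llr[of \<theta> a \<eta>] by (auto simp: has_bochner_integral_iff)
  have mfin: "m 1 a < \<infinity>" "m (- 1) a < \<infinity>" for a
    using int[of a] by (auto simp: m_def real_integrable_def less_top)
  have mdiff: "enn2real (m 1 a) - enn2real (m (- 1) a) = (\<theta> $ a - \<eta> $ a)\<^sup>2 / 2" for a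
    using real_lebesgue_integral_def[OF int[of a]] mean[of a] by (simp add: m_def)
  note Nfin = exp_pulls_finite[OF fin]
  have IV: "(\<integral>\<^sup>+\<omega>. V \<sigma> \<omega> \<partial>bandit_space \<theta>) = (\<Sum>a\<in>UNIV. exp_pulls \<theta> \<pi> stop a * m \<sigma> a)" for \<sigma>
    unfolding V_def m_def by (rule wald) measurable
  have prodfin: "exp_pulls \<theta> \<pi> stop a * m \<sigma> a < \<infinity>" if "\<sigma> = 1 \<or> \<sigma> = -1" for a \<sigma>
    using Nfin mfin that by (auto simp: ennreal_mult_less_top)
  have EV: "has_bochner_integral (bandit_space \<theta>) (\<lambda>\<omega>. enn2real (V \<sigma> \<omega>))
      (\<Sum>a\<in>UNIV. enn2real (exp_pulls \<theta> \<pi> stop a) * enn2real (m \<sigma> a))" if "\<sigma> = 1 \<or> \<sigma> = -1" for \<sigma>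
  proof -
    have "(\<integral>\<^sup>+\<omega>. V \<sigma> \<omega> \<partial>bandit_space \<theta>) < \<infinity>"
      unfolding IV using prodfin[OF that] by (simp add: less_top)
    from has_bochner_integral_enn2real[OF _ this] show ?thesis
      unfolding IV by (simp add: enn2real_sum[OF prodfin[OF that]] enn2real_mult)
  qed
  have "has_bochner_integral (bandit_space \<theta>) (\<lambda>\<omega>. enn2real (V 1 \<omega>) - enn2real (V (- 1) \<omega>))
     ((\<Sum>a\<in>UNIV. enn2real (exp_pulls \<theta> \<pi> stop a) * enn2real (m 1 a)) -
      (\<Sum>a\<in>UNIV. enn2real (exp_pulls \<theta> \<pi> stop a) * enn2real (m (- 1) a)))"
    by (intro has_bochner_integral_diff EV) auto
  then have *: "has_bochner_integral (bandit_space \<theta>) (\<lambda>\<omega>. enn2real (V 1 \<omega>) - enn2real (V (- 1) \<omega>))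
      (\<Sum>a\<in>UNIV. enn2real (exp_pulls \<theta> \<pi> stop a) * ((\<theta> $ a - \<eta> $ a)\<^sup>2 / 2))"
    by (simp only: mdiff[symmetric] sum_subtractf[symmetric] right_diff_distrib)
  show ?thesis
  proof (rule has_bochner_integral_cong_AE[THEN iffD1, OF _ _ _ *])
    show "AE \<omega> in bandit_space \<theta>. enn2real (V 1 \<omega>) - enn2real (V (- 1) \<omega>) =
        log_lik \<pi> \<theta> \<eta> \<omega> (the_enat (\<tau> \<omega>))"
      using AE_stop
    proof eventually_elim
      case (elim \<omega>)
      then obtain n where n: "\<tau> \<omega> = enat n" by auto
      have "V \<sigma> \<omega> = (\<Sum>t<n. ennreal (max 0 (\<sigma> * llr \<theta> \<eta> (arm_at \<pi> \<omega> t) (reward_at \<pi> \<omega> t))))" for \<sigma>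
        unfolding V_def n suminf_before_enat by (intro sum.cong) (auto simp: max_def ennreal_neg)
      then have "enn2real (V \<sigma> \<omega>) = (\<Sum>t<n. max 0 (\<sigma> * llr \<theta> \<eta> (arm_at \<pi> \<omega> t) (reward_at \<pi> \<omega> t)))" for \<sigma>
        by (simp only: sum_ennreal max.cobounded1 enn2real_ennreal sum_nonneg)
      then show ?case
        unfolding n log_lik_def
        by (simp add: sum_subtractf[symmetric]) (intro sum.cong, auto simp: max_def)
    qed
  qed measurable
qed

lemma measure_decides_eq:
  "measure (bandit_space \<theta>) {\<omega>. decides (\<lambda>a. a \<noteq> b) \<omega>} + measure (bandit_space \<theta>) {\<omega>. decides (\<lambda>a. a = b) \<omega>}
    = prob_stop \<theta> \<pi> stop"
proof -
  interpret prob_space "bandit_space \<theta>" by (rule prob_space_bandit_space)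
  have S: "{\<omega>. decides D \<omega>} \<in> sets (bandit_space \<theta>)" for D
    using measurable_decides[of D] by (simp add: pred_def)
  have "{\<omega> \<in> space (bandit_space \<theta>). \<tau> \<omega> < \<infinity>} =
      {\<omega>. decides (\<lambda>a. a \<noteq> b) \<omega>} \<union> {\<omega>. decides (\<lambda>a. a = b) \<omega>}"
    and "{\<omega>. decides (\<lambda>a. a \<noteq> b) \<omega>} \<inter> {\<omega>. decides (\<lambda>a. a = b) \<omega>} = {}"
    by (auto simp: decides_def)
  then show ?thesis
    unfolding prob_stop_def using finite_measure_Union[OF S S] by simp
qed

lemma prob_error_eq: "prob_error \<theta> \<pi> stop dec = measure (bandit_space \<theta>) {\<omega>. decides (\<lambda>a. a \<noteq> best_arm \<theta>) \<omega>}"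
  by (simp add: prob_error_def decides_def)

text \<open>The left side is the relative entropy of two coins with bias \<open>\<delta>\<close> and
  \<open>1 - \<delta>\<close>. A linear bound tight in this extremal case replaces the relative
  entropy of the actual error probabilities; this avoids its monotonicity and the degenerate
  probabilities 0 and 1.\<close>

lemma transportation:
  assumes \<delta>: "0 < \<delta>" "\<delta> < 1/2"
    and pac\<theta>: "pac_at \<delta> \<theta> \<pi> stop dec" and pac\<eta>: "pac_at \<delta> \<eta> \<pi> stop dec"
    and best: "best_arm \<theta> \<noteq> best_arm \<eta>" and fin: "exp_tau \<theta> \<pi> stop < \<infinity>"
  shows "(1 - 2 * \<delta>) * ln ((1 - \<delta>) / \<delta>) \<le>
    (\<Sum>a\<in>UNIV. enn2real (exp_pulls \<theta> \<pi> stop a) * ((\<theta> $ a - \<eta> $ a)\<^sup>2 / 2))"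
proof -
  interpret T: prob_space "bandit_space \<theta>" by (rule prob_space_bandit_space)
  interpret E: prob_space "bandit_space \<eta>" by (rule prob_space_bandit_space)
  define Er where "Er = {\<omega>. decides (\<lambda>a. a \<noteq> best_arm \<theta>) \<omega>}"
  define Ok where "Ok = {\<omega>. decides (\<lambda>a. a = best_arm \<theta>) \<omega>}"
  define W where "W \<omega> = log_lik \<pi> \<theta> \<eta> \<omega> (the_enat (\<tau> \<omega>))" for \<omega>
  have W [measurable]: "W \<in> borel_measurable outcome_borel" unfolding W_def by measurable
  have S: "{\<omega>. decides D \<omega>} \<in> sets outcome_borel" for D
    using measurable_decides[of D] by (simp add: pred_def)
  then have [measurable]: "Er \<in> sets outcome_borel" "Ok \<in> sets outcome_borel"
    by (auto simp: Er_def Ok_def)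
  let ?p = "measure (bandit_space \<theta>) Er" and ?q = "measure (bandit_space \<eta>) Er"
  have err: "prob_error \<theta> \<pi> stop dec \<le> \<delta>" "prob_error \<eta> \<pi> stop dec \<le> \<delta>"
    and stops: "prob_stop \<theta> \<pi> stop = 1" "prob_stop \<eta> \<pi> stop = 1"
    using pac\<theta> pac\<eta> unfolding pac_at_def by blast+
  have p: "?p \<le> \<delta>" "measure (bandit_space \<theta>) Ok = 1 - ?p"
    using err(1) measure_decides_eq[of \<theta> "best_arm \<theta>"] stops(1)
    unfolding Er_def Ok_def prob_error_eq by linarith+
  have q: "measure (bandit_space \<eta>) Ok = 1 - ?q"
    using measure_decides_eq[of \<eta> "best_arm \<theta>"] stops(2)
    unfolding Er_def Ok_def by linarith
  have "measure (bandit_space \<eta>) Ok \<le> prob_error \<eta> \<pi> stop dec"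
    unfolding prob_error_eq
  proof (rule E.finite_measure_mono)
    show "Ok \<subseteq> {\<omega>. decides (\<lambda>a. a \<noteq> best_arm \<eta>) \<omega>}"
      using best by (auto simp: Ok_def decides_def)
  qed (simp add: S)
  then have q1: "1 - ?q \<le> \<delta>" using err(2) q by linarith
  have AE_stop: "AE \<omega> in bandit_space \<theta>. \<tau> \<omega> < \<infinity>"
    using T.AE_prob_1[OF stops(1)[unfolded prob_stop_def]] by eventually_elim simp
  have EW: "has_bochner_integral (bandit_space \<theta>) W
      (\<Sum>a\<in>UNIV. enn2real (exp_pulls \<theta> \<pi> stop a) * ((\<theta> $ a - \<eta> $ a)\<^sup>2 / 2))"
    unfolding W_def by (rule expectation_log_lik[OF fin AE_stop])
  have EX: "has_bochner_integral (bandit_space \<theta>) (\<lambda>\<omega>. indicator {\<omega>. decides D \<omega>} \<omega> * exp (- W \<omega>))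
      (measure (bandit_space \<eta>) {\<omega>. decides D \<omega>})" for D
  proof (rule has_bochner_integral_nn_integral)
    have "(\<integral>\<^sup>+\<omega>. ennreal (indicator {\<omega>. decides D \<omega>} \<omega> * exp (- W \<omega>)) \<partial>bandit_space \<theta>) =
        (\<integral>\<^sup>+\<omega>. indicator {\<omega>. decides D \<omega>} \<omega> * ennreal (exp (- W \<omega>)) \<partial>bandit_space \<theta>)"
      by (intro nn_integral_cong) (auto split: split_indicator)
    also have "\<dots> = ennreal (measure (bandit_space \<eta>) {\<omega>. decides D \<omega>})"
      unfolding W_def change_of_measure_decides[symmetric] by (rule E.emeasure_eq_measure)
    finally show "(\<integral>\<^sup>+\<omega>. ennreal (indicator {\<omega>. decides D \<omega>} \<omega> * exp (- W \<omega>)) \<partial>bandit_space \<theta>) = \<dots>" .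
    show "(\<lambda>\<omega>. indicator {\<omega>. decides D \<omega>} \<omega> * exp (- W \<omega>)) \<in> borel_measurable (bandit_space \<theta>)"
      using S[of D] by measurable
  qed auto
  have I: "has_bochner_integral (bandit_space \<theta>) (indicator A :: _ \<Rightarrow> real) (measure (bandit_space \<theta>) A)"
    if "A \<in> sets outcome_borel" for A
    using that by (intro has_bochner_integral_real_indicator) (auto simp: less_top[symmetric])
  \<comment> \<open>Extremal means that \<open>Er\<close> has probability exactly
    \<open>\<delta>\<close> under \<open>\<theta>\<close> and \<open>1 - \<delta>\<close> under
    \<open>\<eta>\<close>, with constant likelihood ratio \<open>exp (- W)\<close> on each of
    \<open>Er\<close> and \<open>Ok\<close>: it is then \<open>c\<close> on \<open>Er\<close> and
    \<open>1 / c\<close> on \<open>Ok\<close>.\<close>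
  define c where "c = (1 - \<delta>) / \<delta>"
  define l where "l = ln c"
  have c: "1 \<le> c" "0 < c" using \<delta> by (auto simp: c_def field_simps)
  have l: "0 \<le> l" using c by (simp add: l_def)
  text \<open>On each of the two events this is \<open>ln u \<le> u - 1\<close> at the ratio of the likelihood to its
    value \<open>c\<close> or \<open>1/c\<close> in the extremal case.\<close>
  have pt: "AE \<omega> in bandit_space \<theta>. - W \<omega> \<le> l * (indicator Er \<omega> - indicator Ok \<omega>)
      + (indicator Er \<omega> * exp (- W \<omega>) / c + c * (indicator Ok \<omega> * exp (- W \<omega>))) - 1"
    using AE_stop
  proof eventually_elim
    case (elim \<omega>)
    have "- W \<omega> - l \<le> exp (- W \<omega> - l) - 1" "- W \<omega> + l \<le> exp (- W \<omega> + l) - 1"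
      using exp_ge_add_one_self[of "- W \<omega> - l"] exp_ge_add_one_self[of "- W \<omega> + l"] by linarith+
    moreover have "exp (- W \<omega> - l) = exp (- W \<omega>) / c" "exp (- W \<omega> + l) = c * exp (- W \<omega>)"
      using c by (simp_all add: exp_diff exp_add exp_minus l_def field_simps)
    moreover have "\<omega> \<in> Er \<and> \<omega> \<notin> Ok \<or> \<omega> \<notin> Er \<and> \<omega> \<in> Ok"
      using elim by (auto simp: Er_def Ok_def decides_def)
    ultimately show ?case by auto
  qed
  have "- (\<Sum>a\<in>UNIV. enn2real (exp_pulls \<theta> \<pi> stop a) * ((\<theta> $ a - \<eta> $ a)\<^sup>2 / 2))
      \<le> l * (?p - (1 - ?p)) + (?q / c + c * (1 - ?q)) - 1"
  proof -
    have 2: "has_bochner_integral (bandit_space \<theta>) (\<lambda>\<omega>. - W \<omega>)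
       (- (\<Sum>a\<in>UNIV. enn2real (exp_pulls \<theta> \<pi> stop a) * ((\<theta> $ a - \<eta> $ a)\<^sup>2 / 2)))"
      by (rule has_bochner_integral_minus[OF EW])
    have 1: "has_bochner_integral (bandit_space \<theta>) (\<lambda>\<omega>. 1) (1::real)"
      by (simp add: has_bochner_integral_iff T.prob_space[simplified])
    have 3: "has_bochner_integral (bandit_space \<theta>) (\<lambda>\<omega>. l * (indicator Er \<omega> - indicator Ok \<omega>)
      + (indicator Er \<omega> * exp (- W \<omega>) / c + c * (indicator Ok \<omega> * exp (- W \<omega>))) - 1)
       (l * (?p - (1 - ?p)) + (?q / c + c * (1 - ?q)) - 1)"
      unfolding p(2)[symmetric] q[symmetric]
      by (intro has_bochner_integral_diff has_bochner_integral_add has_bochner_integral_mult_right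
            has_bochner_integral_divide 1 I EX[folded Er_def] EX[of "\<lambda>a. a = best_arm \<theta>", folded Ok_def]
            EX[of "\<lambda>a. a \<noteq> best_arm \<theta>", folded Er_def]) measurable
    show ?thesis
      using integral_mono_AE[OF integrable.intros[OF 2] integrable.intros[OF 3] pt]
      by (simp only: has_bochner_integral_integral_eq[OF 2] has_bochner_integral_integral_eq[OF 3])
  qed
  moreover have "l * (?p - (1 - ?p)) \<le> l * (2 * \<delta> - 1)"
    using p(1) l by (intro mult_left_mono) auto
  \<comment> \<open>As \<open>1 / c \<le> c\<close>, the left side does not increase with
    \<open>?q\<close>; at the least admissible value \<open>?q = 1 - \<delta>\<close> it equals
    1.\<close>
  moreover have "?q / c + c * (1 - ?q) \<le> 1"
  proof -
    have "?q / c + c * (1 - ?q) = 1 / c + (1 - ?q) * (c - 1 / c)"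
      using c by (simp add: field_simps)
    also have "\<dots> \<le> 1 / c + \<delta> * (c - 1 / c)"
      using q1 c by (intro add_left_mono mult_right_mono) (auto simp: field_simps intro: order_trans)
    also have "\<dots> = (1 - \<delta>) * (1 / c) + \<delta> * c"
      by (simp add: algebra_simps diff_divide_distrib)
    also have "\<dots> = 1" using \<delta> by (simp add: c_def)
    finally show ?thesis .
  qed
  ultimately show ?thesis
    unfolding c_def[symmetric] l_def[symmetric] by (simp add: algebra_simps)
qed

end

subsection \<open>Lower bounds on the sample complexity\<close>

text \<open>The confusing instances give arms \<open>a\<close> and \<open>best_arm \<theta>\<close> the common mean \<open>\<mu>\<close>. Some arm other than
  \<open>best_arm \<theta>\<close> is then among the best ones; raising it by \<open>\<epsilon>\<close> makes it the unique best arm, and \<open>\<epsilon> \<rightarrow> 0\<close>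
  removes the contribution of this perturbation.\<close>
lemma pair_transportation:
  fixes \<theta> :: "real^'k::finite"
  assumes alg: "measurable_alg \<pi> stop dec" and \<delta>: "0 < \<delta>" "\<delta> < 1/2"
    and pac: "\<And>\<theta>. \<theta> \<in> Theta \<Longrightarrow> pac_at \<delta> \<theta> \<pi> stop dec"
    and \<theta>: "\<theta> \<in> Theta" and fin: "exp_tau \<theta> \<pi> stop < \<infinity>" and a: "a \<noteq> best_arm \<theta>"
  defines "N \<equiv> \<lambda>b. enn2real (exp_pulls \<theta> \<pi> stop b)"
  shows "(1 - 2 * \<delta>) * ln ((1 - \<delta>) / \<delta>) \<le>
    (N (best_arm \<theta>) * (\<theta> $ best_arm \<theta> - \<mu>)\<^sup>2 + N a * (\<theta> $ a - \<mu>)\<^sup>2) / 2"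
proof -
  interpret bandit_alg \<pi> stop dec by unfold_locales (rule alg)
  let ?b = "best_arm \<theta>" and ?K = "(1 - 2 * \<delta>) * ln ((1 - \<delta>) / \<delta>)"
  define \<xi> where "\<xi> = (\<lambda>d. if d = a \<or> d = ?b then \<mu> else \<theta> $ d)"
  obtain c0 where c0: "\<And>d. \<xi> d \<le> \<xi> c0"
  proof -
    have "Max (range \<xi>) \<in> range \<xi>" by (rule Max_in) auto
    then obtain c where "Max (range \<xi>) = \<xi> c" by blast
    moreover have "\<xi> d \<le> Max (range \<xi>)" for d by (rule Max_ge) auto
    ultimately have "\<xi> d \<le> \<xi> c" for d by simp
    then show ?thesis by (rule that)
  qed
  \<comment> \<open>If the maximum is attained at the best arm of \<open>\<theta>\<close>, it is
    attained at \<open>a\<close> as well, because both have mean \<open>\<mu>\<close>. The arm to be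
    raised can therefore avoid \<open>?b\<close>, which makes the best arms of the two instances
    differ.\<close>
  obtain c where c: "c \<noteq> ?b" "\<And>d. \<xi> d \<le> \<xi> c"
  proof (cases "c0 = ?b")
    case True
    then have "\<xi> c0 = \<xi> a" by (simp add: \<xi>_def)
    then show ?thesis by (intro that[OF a]) (metis c0)
  next
    case False
    then show ?thesis by (rule that) (rule c0)
  qed
  define \<eta> :: "real \<Rightarrow> real^'k" where "\<eta> \<epsilon> = (\<chi> d. \<xi> d + \<epsilon> * of_bool (d = c))" for \<epsilon>
  have bound: "?K \<le> (\<Sum>d\<in>UNIV. N d * ((\<theta> $ d - (\<xi> d + \<epsilon> * of_bool (d = c)))\<^sup>2 / 2))" if \<epsilon>: "\<epsilon> > 0" for \<epsilon>
  proof -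
    have le: "\<eta> \<epsilon> $ d \<le> \<eta> \<epsilon> $ c" for d
      using c(2)[of d] \<epsilon> by (simp add: \<eta>_def)
    have uniq: "d = c" if d: "\<forall>e. \<eta> \<epsilon> $ e \<le> \<eta> \<epsilon> $ d" for d
    proof (rule ccontr)
      assume "d \<noteq> c"
      then show False using d[rule_format, of c] c(2)[of d] \<epsilon> by (simp add: \<eta>_def)
    qed
    have T: "\<eta> \<epsilon> \<in> Theta"
      unfolding Theta_def by (intro CollectI ex1I[of _ c]) (simp add: le, rule uniq)
    have "c = best_arm (\<eta> \<epsilon>)" by (rule best_arm_unique[OF T, THEN iffD1]) (simp add: le)
    then have "best_arm \<theta> \<noteq> best_arm (\<eta> \<epsilon>)" using c(1) by simp
    from transportation[OF \<delta> pac[OF \<theta>] pac[OF T] this fin] show ?thesis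
      by (simp add: N_def \<eta>_def)
  qed
  have "((\<lambda>\<epsilon>. \<Sum>d\<in>UNIV. N d * ((\<theta> $ d - (\<xi> d + \<epsilon> * of_bool (d = c)))\<^sup>2 / 2)) \<longlongrightarrow>
      (\<Sum>d\<in>UNIV. N d * ((\<theta> $ d - (\<xi> d + 0 * of_bool (d = c)))\<^sup>2 / 2))) (at_right 0)"
    by (intro tendsto_intros) auto
  moreover have "\<forall>\<^sub>F \<epsilon> in at_right 0.
      ?K \<le> (\<Sum>d\<in>UNIV. N d * ((\<theta> $ d - (\<xi> d + \<epsilon> * of_bool (d = c)))\<^sup>2 / 2))"
    using eventually_at_right_less[of 0] by eventually_elim (rule bound)
  ultimately have "?K \<le> (\<Sum>d\<in>UNIV. N d * ((\<theta> $ d - (\<xi> d + 0 * of_bool (d = c)))\<^sup>2 / 2))"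
    by (rule tendsto_lowerbound) simp
  also have "\<dots> = (\<Sum>d\<in>{?b, a}. N d * ((\<theta> $ d - (\<xi> d + 0 * of_bool (d = c)))\<^sup>2 / 2))"
    by (rule sum.mono_neutral_right) (auto simp: \<xi>_def)
  also have "\<dots> = (N ?b * (\<theta> $ ?b - \<mu>)\<^sup>2 + N a * (\<theta> $ a - \<mu>)\<^sup>2) / 2"
    using a by (simp add: \<xi>_def add_divide_distrib)
  finally show ?thesis .
qed

text \<open>The common input of both lower bounds: fairness is left as an implication for an
  arbitrary share \<open>q\<close>, so exact and approximate shares are treated alike.\<close>

lemma pull_frequencies:
  fixes \<theta> :: "real^'k::finite"
  assumes alg: "measurable_alg \<pi> stop dec" and \<delta>: "0 < \<delta>" "\<delta> < 1/2"
    and pac: "\<And>\<theta>. \<theta> \<in> Theta \<Longrightarrow> pac_at \<delta> \<theta> \<pi> stop dec"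
    and \<theta>: "\<theta> \<in> Theta" and fin: "exp_tau \<theta> \<pi> stop < \<infinity>" and card: "CARD('k) \<ge> 2"
  obtains T :: real and w :: "real^'k" where
    "exp_tau \<theta> \<pi> stop = ennreal T" "0 < T"
    "\<And>a. 0 \<le> w $ a" "\<And>a. w $ a \<le> 1" "(\<Sum>a\<in>UNIV. w $ a) = 1"
    "\<And>a q. ennreal q * exp_tau \<theta> \<pi> stop \<le> exp_pulls \<theta> \<pi> stop a \<Longrightarrow> q \<le> w $ a"
    "\<And>a \<mu>. a \<noteq> best_arm \<theta> \<Longrightarrow> (1 - 2 * \<delta>) * ln ((1 - \<delta>) / \<delta>) \<le>
      T * ((w $ best_arm \<theta> * (\<theta> $ best_arm \<theta> - \<mu>)\<^sup>2 + w $ a * (\<theta> $ a - \<mu>)\<^sup>2) / 2)"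
proof -
  interpret bandit_alg \<pi> stop dec by unfold_locales (rule alg)
  define N where "N b = enn2real (exp_pulls \<theta> \<pi> stop b)" for b
  define T where "T = (\<Sum>b\<in>UNIV. N b)"
  define w :: "real^'k" where "w = (\<chi> b. N b / T)"
  have N0: "0 \<le> N b" for b by (simp add: N_def)
  have N: "exp_pulls \<theta> \<pi> stop b = ennreal (N b)" for b
    using exp_pulls_finite[OF fin, of b] by (simp add: N_def less_top)
  have T: "exp_tau \<theta> \<pi> stop = ennreal T"
    unfolding exp_tau_eq_sum_exp_pulls N T_def by (rule sum_ennreal) (rule N0)
  have bound: "(1 - 2 * \<delta>) * ln ((1 - \<delta>) / \<delta>) \<le>
      (N (best_arm \<theta>) * (\<theta> $ best_arm \<theta> - \<mu>)\<^sup>2 + N a * (\<theta> $ a - \<mu>)\<^sup>2) / 2"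
    if "a \<noteq> best_arm \<theta>" for a \<mu>
    unfolding N_def using pair_transportation[OF alg \<delta> pac \<theta> fin that] .
  \<comment> \<open>Dividing by the expected duration is legitimate because a run with no expected
    pulls would force the strictly positive information bound to be at most zero.\<close>
  have "T \<noteq> 0"
  proof
    assume "T = 0"
    then have "N b = 0" for b using N0 by (simp add: T_def sum_nonneg_eq_0_iff)
    moreover obtain a where "a \<noteq> best_arm \<theta>" by (rule ex_suboptimal[OF card])
    ultimately have "(1 - 2 * \<delta>) * ln ((1 - \<delta>) / \<delta>) \<le> 0" using bound[of a 0] by simp
    moreover have "0 < ln ((1 - \<delta>) / \<delta>)" using \<delta> by (intro ln_gt_zero) (simp add: field_simps)
    ultimately show False using \<delta> by (simp add: mult_le_0_iff)
  qed
  then have Tpos: "0 < T" using N0 by (simp add: T_def sum_nonneg less_le)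
  have Nw: "N b = T * w $ b" for b using Tpos by (simp add: w_def)
  show ?thesis
  proof (rule that[OF T Tpos])
    show w0: "0 \<le> w $ b" for b using N0[of b] Tpos by (simp add: w_def)
    have "N b \<le> T" for b unfolding T_def by (rule member_le_sum) (auto simp: N0)
    then show "w $ b \<le> 1" for b using Tpos by (simp add: w_def)
    show "(\<Sum>b\<in>UNIV. w $ b) = 1" using Tpos by (simp add: w_def T_def flip: sum_divide_distrib)
    \<comment> \<open>A relaxed share \<open>p \<theta> $ a - \<epsilon>\<close> may be negative.
      Then \<open>ennreal q\<close> is zero and the premise says nothing, but the conclusion holds
      since frequencies are nonnegative.\<close>
    show "q \<le> w $ b" if "ennreal q * exp_tau \<theta> \<pi> stop \<le> exp_pulls \<theta> \<pi> stop b" for b q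
    proof (cases "0 \<le> q")
      case True
      then have "q * T \<le> N b"
        using that Tpos N0 by (simp add: T N flip: ennreal_mult)
      then show ?thesis using Tpos by (simp add: w_def field_simps)
    next
      case False
      then show ?thesis using w0[of b] by simp
    qed
    show "(1 - 2 * \<delta>) * ln ((1 - \<delta>) / \<delta>) \<le>
        T * ((w $ best_arm \<theta> * (\<theta> $ best_arm \<theta> - \<mu>)\<^sup>2 + w $ a * (\<theta> $ a - \<mu>)\<^sup>2) / 2)"
      if "a \<noteq> best_arm \<theta>" for a \<mu>
      using bound[OF that, of \<mu>] by (simp add: Nw algebra_simps)
  qed
qed

section \<open>The two lower bounds\<close>

lemma fair_PAC_lower_bound:
  fixes p :: "real^'k::finite"
  assumes card: "CARD('k) \<ge> 2" and fair: "fair_PAC p \<pi> stop dec"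
    and \<theta>: "\<theta> \<in> Theta" and \<delta>: "0 < \<delta>" "\<delta> < 1/2"
  shows "T_star p \<theta> * ereal (ln (1 / (2.4 * \<delta>))) \<le> enn2ereal (exp_tau \<theta> (\<pi> \<delta>) (stop \<delta>))"
proof -
  let ?L = "ln (1 / (2.4 * \<delta>))"
  have alg: "measurable_alg (\<pi> \<delta>) (stop \<delta>) (dec \<delta>)"
    and pac: "\<And>\<theta>. \<theta> \<in> Theta \<Longrightarrow> pac_at \<delta> \<theta> (\<pi> \<delta>) (stop \<delta>) (dec \<delta>)"
    and arm_share: "\<And>a. ennreal (p $ a) * exp_tau \<theta> (\<pi> \<delta>) (stop \<delta>) \<le> exp_pulls \<theta> (\<pi> \<delta>) (stop \<delta>) a"
    using fair \<theta> \<delta> by (auto simp: fair_PAC_def)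
  consider "exp_tau \<theta> (\<pi> \<delta>) (stop \<delta>) = \<infinity>" | "?L \<le> 0" | "exp_tau \<theta> (\<pi> \<delta>) (stop \<delta>) < \<infinity>" "0 < ?L"
    by (metis infinity_ennreal_def less_top not_le_imp_less)
  then show ?thesis
  proof cases
    case 1
    then show ?thesis by simp
  next
    case 2
    then have "T_star p \<theta> * ereal ?L \<le> 0"
      using ereal_mult_left_mono[of "ereal ?L" 0 "T_star p \<theta>"] T_star_nonneg[OF card, of p \<theta>] by simp
    also have "0 \<le> enn2ereal (exp_tau \<theta> (\<pi> \<delta>) (stop \<delta>))" by simp
    finally show ?thesis .
  next
    case 3
    obtain T w where T: "exp_tau \<theta> (\<pi> \<delta>) (stop \<delta>) = ennreal T" "0 < T"
      and w: "\<And>a. 0 \<le> w $ a" "\<And>a. w $ a \<le> 1" "(\<Sum>a\<in>UNIV. w $ a) = 1"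
      and freq: "\<And>a q. ennreal q * exp_tau \<theta> (\<pi> \<delta>) (stop \<delta>) \<le> exp_pulls \<theta> (\<pi> \<delta>) (stop \<delta>) a \<Longrightarrow> q \<le> w $ a"
      and bound: "\<And>a \<mu>. a \<noteq> best_arm \<theta> \<Longrightarrow> (1 - 2 * \<delta>) * ln ((1 - \<delta>) / \<delta>) \<le>
        T * ((w $ best_arm \<theta> * (\<theta> $ best_arm \<theta> - \<mu>)\<^sup>2 + w $ a * (\<theta> $ a - \<mu>)\<^sup>2) / 2)"
      using pull_frequencies[OF alg \<delta> pac \<theta> 3(1) card] by blast
    have "w \<in> Sigma_p p" using w freq[OF arm_share] by (simp add: Sigma_p_def)
    from T_star_mult_le[OF \<theta> this 3(2) order_trans[OF binary_kl_ge_ln[OF \<delta>] bound] less_imp_le[OF T(2)]]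
    have "T_star p \<theta> * ereal ?L \<le> ereal T" .
    then show ?thesis using T by simp
  qed
qed

text \<open>Passing to a limit of frequencies along a sequence that violates the bound yields one
  weight vector satisfying the exact constraints. No semicontinuity of \<open>T_star\<close> in its
  constraint vector has to be established.\<close>

lemma asym_fair_PAC_lower_bound:
  fixes p :: "real^'k::finite \<Rightarrow> real^'k"
  assumes card: "CARD('k) \<ge> 2" and fair: "asym_fair_PAC p \<pi> stop dec" and \<theta>: "\<theta> \<in> Theta"
  shows "T_star (p \<theta>) \<theta> \<le>
    Liminf (at_right 0) (\<lambda>\<delta>. enn2ereal (exp_tau \<theta> (\<pi> \<delta>) (stop \<delta>)) / ereal (ln (1 / \<delta>)))"
  unfolding le_Liminf_iff
proof (intro allI impI, rule ccontr)
  let ?\<tau> = "\<lambda>\<delta>. exp_tau \<theta> (\<pi> \<delta>) (stop \<delta>)" and ?b = "best_arm \<theta>"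
  let ?X = "\<lambda>\<delta>. enn2ereal (?\<tau> \<delta>) / ereal (ln (1 / \<delta>))"
  fix y assume y: "y < T_star (p \<theta>) \<theta>" and not_ev: "\<not> (\<forall>\<^sub>F \<delta> in at_right 0. y < ?X \<delta>)"
  have alg: "measurable_alg (\<pi> \<delta>) (stop \<delta>) (dec \<delta>)" for \<delta>
    using fair by (simp add: asym_fair_PAC_def)
  have pac: "pac_at \<delta> \<theta> (\<pi> \<delta>) (stop \<delta>) (dec \<delta>)" if "\<theta> \<in> Theta" "0 < \<delta>" "\<delta> < 1/2" for \<theta> \<delta>
    using fair that by (auto simp: asym_fair_PAC_def)
  have arm_share: "\<forall>\<^sub>F \<delta> in at_right 0. ennreal (p \<theta> $ a - \<epsilon>) * ?\<tau> \<delta> \<le> exp_pulls \<theta> (\<pi> \<delta>) (stop \<delta>) a"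
    if "\<epsilon> > 0" for a \<epsilon>
    using fair \<theta> that by (simp add: asym_fair_PAC_def)
  \<comment> \<open>The failure to be eventually above \<open>y\<close> supplies arbitrarily small
    levels with \<open>?X \<delta> \<le> y\<close>. The share conditions hold eventually and there
    are finitely many arms, so a single level can meet all requirements.\<close>
  let ?good = "\<lambda>n \<delta>. 0 < \<delta> \<and> \<delta> < 1/2 \<and> \<delta> < inverse (real (Suc n)) \<and> ?X \<delta> \<le> y \<and>
      (\<forall>a. ennreal (p \<theta> $ a - inverse (real (Suc n))) * ?\<tau> \<delta> \<le> exp_pulls \<theta> (\<pi> \<delta>) (stop \<delta>) a)"
  have "\<exists>\<delta>. ?good n \<delta>" for n
  proof (rule ccontr)
    assume no: "\<nexists>\<delta>. ?good n \<delta>"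
    have small: "\<forall>\<^sub>F \<delta> in at_right 0. 0 < \<delta> \<and> \<delta> < r" if "r > 0" for r :: real
      using that unfolding eventually_at_right_field by (intro exI[of _ r]) auto
    have "\<forall>\<^sub>F \<delta> in at_right 0. 0 < \<delta> \<and> \<delta> < min (1/2) (inverse (real (Suc n)))"
      by (rule small) simp
    moreover have "\<forall>\<^sub>F \<delta> in at_right 0.
        \<forall>a. ennreal (p \<theta> $ a - inverse (real (Suc n))) * ?\<tau> \<delta> \<le> exp_pulls \<theta> (\<pi> \<delta>) (stop \<delta>) a"
      by (intro eventually_all_finite arm_share) simp
    ultimately have "\<forall>\<^sub>F \<delta> in at_right 0. y < ?X \<delta>"
    proof eventually_elim
      case (elim \<delta>)
      then have "0 < \<delta>" "\<delta> < 1/2" "\<delta> < inverse (real (Suc n))" by simp_all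
      then have "\<not> ?X \<delta> \<le> y" using no elim(2) by blast
      then show ?case by (simp add: not_le)
    qed
    with not_ev show False by blast
  qed
  then obtain D where "\<forall>n. ?good n (D n)" by metis
  then have D: "0 < D n" "D n < 1/2" "D n < inverse (real (Suc n))" "?X (D n) \<le> y"
    "\<And>a. ennreal (p \<theta> $ a - inverse (real (Suc n))) * ?\<tau> (D n) \<le> exp_pulls \<theta> (\<pi> (D n)) (stop (D n)) a" for n
    by blast+
  have ln_pos: "0 < ln (1 / D n)" for n
    using D(1,2)[of n] by (intro ln_gt_zero) (simp add: field_simps)
  \<comment> \<open>Nonnegativity of the ratio gives \<open>0 \<le> y\<close>, and \<open>y\<close>
    lies strictly below \<open>T_star\<close>; hence \<open>y\<close> is a real number and the
    expectations along the sequence are finite.\<close>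
  have "0 \<le> ?X (D 0)"
    unfolding divide_ereal_def using ln_pos[of 0] by (intro ereal_0_le_mult inverse_ereal_ge0I) auto
  then have "0 \<le> y" using D(4)[of 0] by (rule order_trans)
  with y obtain Y where Y: "y = ereal Y" "0 \<le> Y" by (cases y) auto
  have \<tau>_le: "enn2ereal (?\<tau> (D n)) \<le> ereal (Y * ln (1 / D n))" for n
    using D(4)[of n] ln_pos[of n] by (simp add: Y ereal_divide_le_pos mult.commute)
  have \<tau>_fin: "?\<tau> (D n) < \<infinity>" for n
  proof -
    have "?\<tau> (D n) \<noteq> \<infinity>" using \<tau>_le[of n] by (cases "?\<tau> (D n) = \<infinity>") auto
    then show ?thesis by (simp add: less_top)
  qed
  \<comment> \<open>Bounding the expected duration by \<open>Y * ln (1 / D n)\<close> and dividing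
    by this logarithm leaves inequalities in \<open>w\<close> alone. The factor 2.4 survives as a
    correction that tends to zero.\<close>
  have "\<exists>w :: real^'k. (\<forall>a. 0 \<le> w $ a) \<and> (\<forall>a. w $ a \<le> 1) \<and> (\<Sum>a\<in>UNIV. w $ a) = 1 \<and>
      (\<forall>a. p \<theta> $ a - inverse (real (Suc n)) \<le> w $ a) \<and>
      (\<forall>a \<mu>. a \<noteq> ?b \<longrightarrow> 1 - ln 2.4 / ln (1 / D n) \<le>
        Y * ((w $ ?b * (\<theta> $ ?b - \<mu>)\<^sup>2 + w $ a * (\<theta> $ a - \<mu>)\<^sup>2) / 2))" for n
  proof -
    obtain T w where T: "?\<tau> (D n) = ennreal T" "0 < T"
      and w: "\<And>a. 0 \<le> w $ a" "\<And>a. w $ a \<le> 1" "(\<Sum>a\<in>UNIV. w $ a) = 1"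
      and freq: "\<And>a q. ennreal q * ?\<tau> (D n) \<le> exp_pulls \<theta> (\<pi> (D n)) (stop (D n)) a \<Longrightarrow> q \<le> w $ a"
      and bound: "\<And>a \<mu>. a \<noteq> ?b \<Longrightarrow> (1 - 2 * D n) * ln ((1 - D n) / D n) \<le>
        T * ((w $ ?b * (\<theta> $ ?b - \<mu>)\<^sup>2 + w $ a * (\<theta> $ a - \<mu>)\<^sup>2) / 2)"
      using pull_frequencies[OF alg D(1,2) pac[OF _ D(1,2)] \<theta> \<tau>_fin card] by blast
    have TY: "T \<le> Y * ln (1 / D n)" using \<tau>_le[of n] T by simp
    have "1 - ln 2.4 / ln (1 / D n) \<le> Y * ((w $ ?b * (\<theta> $ ?b - \<mu>)\<^sup>2 + w $ a * (\<theta> $ a - \<mu>)\<^sup>2) / 2)"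
      if "a \<noteq> ?b" for a \<mu>
    proof -
      let ?S = "(w $ ?b * (\<theta> $ ?b - \<mu>)\<^sup>2 + w $ a * (\<theta> $ a - \<mu>)\<^sup>2) / 2"
      have "ln (1 / D n) - ln 2.4 = ln (1 / (2.4 * D n))"
        using D(1)[of n] by (simp add: ln_div ln_mult)
      also have "\<dots> \<le> T * ?S"
        by (rule order_trans[OF binary_kl_ge_ln[OF D(1,2)] bound[OF that]])
      also have "\<dots> \<le> Y * ln (1 / D n) * ?S"
        using w(1) by (intro mult_right_mono TY) (simp add: add_nonneg_nonneg)
      finally have "(ln (1 / D n) - ln 2.4) / ln (1 / D n) \<le> Y * ?S"
        using ln_pos[of n] by (simp add: pos_divide_le_eq mult.commute mult.left_commute)
      then show ?thesis using ln_pos[of n] by (simp add: diff_divide_distrib)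
    qed
    then show ?thesis using w freq[OF D(5)] by blast
  qed
  then obtain w :: "nat \<Rightarrow> real^'k" where
    w: "\<And>n a. 0 \<le> w n $ a" "\<And>n a. w n $ a \<le> 1" "\<And>n. (\<Sum>a\<in>UNIV. w n $ a) = 1"
      "\<And>n a. p \<theta> $ a - inverse (real (Suc n)) \<le> w n $ a"
      "\<And>n a \<mu>. a \<noteq> ?b \<Longrightarrow> 1 - ln 2.4 / ln (1 / D n) \<le>
        Y * ((w n $ ?b * (\<theta> $ ?b - \<mu>)\<^sup>2 + w n $ a * (\<theta> $ a - \<mu>)\<^sup>2) / 2)"
    by metis
  have "compact (cbox 0 (\<chi> a. 1) :: (real^'k) set)" by (rule compact_cbox)
  moreover have "\<forall>n. w n \<in> cbox 0 (\<chi> a. 1)" using w(1,2) by (simp add: mem_box_cart)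
  ultimately obtain l r where r: "strict_mono (r :: nat \<Rightarrow> nat)" and lim: "(w \<circ> r) \<longlonglongrightarrow> l"
    unfolding compact_eq_seq_compact_metric seq_compact_def by metis
  have lim_nth: "(\<lambda>n. w (r n) $ a) \<longlonglongrightarrow> l $ a" for a
    using tendsto_vec_nth[OF lim, of a] by (simp add: comp_def)
  have inv0: "(\<lambda>n. inverse (real (Suc (r n)))) \<longlonglongrightarrow> 0"
    using LIMSEQ_subseq_LIMSEQ[OF LIMSEQ_inverse_real_of_nat r] by (simp add: comp_def)
  have "(\<lambda>n. D (r n)) \<longlonglongrightarrow> 0"
    by (rule real_tendsto_sandwich[OF _ _ tendsto_const inv0]) (auto intro!: always_eventually less_imp_le D(1,3) simp del: of_nat_Suc)
  then have "filterlim (\<lambda>n. D (r n)) (at_right 0) sequentially"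
    using D(1) less_imp_neq[OF D(1), symmetric] by (auto simp: filterlim_at intro!: always_eventually)
  then have "filterlim (\<lambda>n. ln (D (r n))) at_bot sequentially"
    by (rule filterlim_compose[OF ln_at_0])
  then have "filterlim (\<lambda>n. ln (1 / D (r n))) at_top sequentially"
    using D(1) by (simp add: ln_div filterlim_uminus_at_top less_imp_neq[symmetric])
  then have "(\<lambda>n. ln 2.4 / ln (1 / D (r n))) \<longlonglongrightarrow> 0"
    by (intro tendsto_divide_0[OF tendsto_const] filterlim_at_top_imp_at_infinity)
  from tendsto_diff[OF tendsto_const this, of 1]
  have lim1: "(\<lambda>n. 1 - ln 2.4 / ln (1 / D (r n))) \<longlonglongrightarrow> 1" by simp
  have "l \<in> Sigma_p (p \<theta>)"
    unfolding Sigma_p_def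
  proof (intro CollectI conjI allI)
    fix a
    show "0 \<le> l $ a" "l $ a \<le> 1"
      by (rule LIMSEQ_le_const[OF lim_nth] LIMSEQ_le_const2[OF lim_nth]; use w in blast)+
    have "(\<lambda>n. p \<theta> $ a - inverse (real (Suc (r n)))) \<longlonglongrightarrow> p \<theta> $ a - 0"
      by (intro tendsto_intros inv0)
    from LIMSEQ_le[OF this lim_nth] show "p \<theta> $ a \<le> l $ a" using w(4) by simp
  next
    have "(\<lambda>n. \<Sum>a\<in>UNIV. w (r n) $ a) \<longlonglongrightarrow> (\<Sum>a\<in>UNIV. l $ a)"
      by (intro tendsto_sum lim_nth)
    then show "(\<Sum>a\<in>UNIV. l $ a) = 1" by (simp add: w(3) LIMSEQ_const_iff)
  qed
  moreover have "1 \<le> Y * ((l $ ?b * (\<theta> $ ?b - \<mu>)\<^sup>2 + l $ a * (\<theta> $ a - \<mu>)\<^sup>2) / 2)" if "a \<noteq> ?b" for a \<mu>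
  proof (rule LIMSEQ_le[OF lim1])
    show "(\<lambda>n. Y * ((w (r n) $ ?b * (\<theta> $ ?b - \<mu>)\<^sup>2 + w (r n) $ a * (\<theta> $ a - \<mu>)\<^sup>2) / 2)) \<longlonglongrightarrow>
        Y * ((l $ ?b * (\<theta> $ ?b - \<mu>)\<^sup>2 + l $ a * (\<theta> $ a - \<mu>)\<^sup>2) / 2)"
      by (intro tendsto_intros lim_nth) simp
  qed (use w(5)[OF that] in blast)
  \<comment> \<open>After the normalisation the information level is 1 and the duration is
    \<open>Y\<close>, so the characteristic time is at most \<open>y\<close>, against the choice of
    \<open>y\<close>.\<close>
  ultimately have "T_star (p \<theta>) \<theta> * ereal 1 \<le> ereal Y"
    using Y(2) by (intro T_star_mult_le[OF \<theta>]) auto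
  with y Y show False by simp
qed

theorem theorem1:
  assumes "CARD('k::finite) \<ge> 2"
  shows
    "(\<forall>(p::real^'k) \<pi> stop dec.
        (\<forall>a. 0 \<le> p $ a \<and> p $ a \<le> 1) \<and> (\<Sum>a\<in>UNIV. p $ a) \<le> 1 \<and> fair_PAC p \<pi> stop dec \<longrightarrow>
        (\<forall>\<theta>\<in>Theta. \<forall>\<delta>\<in>{0<..<1/2}.
           T_star p \<theta> * ereal (ln (1 / (2.4 * \<delta>))) \<le> enn2ereal (exp_tau \<theta> (\<pi> \<delta>) (stop \<delta>))))
   \<and>
    (\<forall>(p::real^'k \<Rightarrow> real^'k) \<pi> stop dec.
        continuous_on UNIV p \<and> (\<forall>\<theta>' a. 0 \<le> p \<theta>' $ a \<and> p \<theta>' $ a \<le> 1) \<and>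
        (\<forall>\<theta>'. (\<Sum>a\<in>UNIV. p \<theta>' $ a) \<le> 1) \<and> asym_fair_PAC p \<pi> stop dec \<longrightarrow>
        (\<forall>\<theta>\<in>Theta.
           Liminf (at_right 0) (\<lambda>\<delta>. enn2ereal (exp_tau \<theta> (\<pi> \<delta>) (stop \<delta>)) / ereal (ln (1 / \<delta>)))
             \<ge> T_star (p \<theta>) \<theta>))"
proof (intro conjI allI impI ballI; elim conjE)
  fix p :: "real^'k" and \<pi> stop dec and \<theta> :: "real^'k" and \<delta> :: real
  assume "fair_PAC p \<pi> stop dec" "\<theta> \<in> Theta" "\<delta> \<in> {0<..<1/2}"
  then show "T_star p \<theta> * ereal (ln (1 / (2.4 * \<delta>))) \<le> enn2ereal (exp_tau \<theta> (\<pi> \<delta>) (stop \<delta>))"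
    using fair_PAC_lower_bound[OF assms] by simp
next
  fix p :: "real^'k \<Rightarrow> real^'k" and \<pi> stop dec and \<theta> :: "real^'k"
  assume "asym_fair_PAC p \<pi> stop dec" "\<theta> \<in> Theta"
  then show "Liminf (at_right 0) (\<lambda>\<delta>. enn2ereal (exp_tau \<theta> (\<pi> \<delta>) (stop \<delta>)) / ereal (ln (1 / \<delta>)))
      \<ge> T_star (p \<theta>) \<theta>"
    by (rule asym_fair_PAC_lower_bound[OF assms])
qed

end
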